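(* Let $G$ be a finitely generated branch group. If $G$ contains an element $\alpha$ whose centraliser $C_G(\alpha)$ is not finitely generated, then $G$ is intersection-saturated.
   Context: Branch group: let $T$ be a spherically homogeneous rooted tree (every vertex at level $n$ has the same number $m_{n+1}\geq 2$ of children). A group $G$ is a branch group if it acts faithfully on $T$, transitively on each level of $T$, and for every $n$ the rigid level stabiliser $\mathrm{Rist}_G(n)=\prod_{v \text{ at level } n}\mathrm{Rist}_G(v)$ has finite index in $G$, where $\mathrm{Rist}_G(v)$ is the subgroup of elements of $G$ acting trivially outside the subtree rooted at $v$. For an integer $n\geq 1$ write $[n]=\{1,\dots,n\}$. An $n$-configuration is a map $c\colon \mathcal{P}([n])\setminus\{\emptyset\}\to\{0,1\}$. An $n$-configuration $c$ is realisable in a group $G$ if there exist subgroups $H_1,\dots,H_n\leq G$ such that for every non-empty subset $I\subseteq[n]$, the subgroup $\bigcap_{i\in I}H_i$ is finitely generated if and only if $c(I)=0$. A group $G$ is intersection-saturated if for every $n\geq 1$, every $n$-configuration is realisable in $G$. *)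

theory Defs
  imports "HOL-Algebra.Algebra" "HOL-Library.Sublist"
begin

text \<open>Spherically homogeneous rooted tree with branching sequence k:
  every vertex at level n (a word of length n) has exactly k n children v @ [x], x < k n.
  (So k n is the paper's m_{n+1}.)  Vertices are finite words.\<close>

definition sh_tree :: "(nat \<Rightarrow> nat) \<Rightarrow> nat list set" where
  "sh_tree k = {v. \<forall>i < length v. v ! i < k i}"

definition tree_level :: "(nat \<Rightarrow> nat) \<Rightarrow> nat \<Rightarrow> nat list set" where
  "tree_level k n = {v \<in> sh_tree k. length v = n}"

definition tree_aut :: "(nat \<Rightarrow> nat) \<Rightarrow> (nat list \<Rightarrow> nat list) \<Rightarrow> bool" where
  "tree_aut k f \<longleftrightarrow> (\<forall>u \<in> sh_tree k. \<forall>v \<in> sh_tree k. prefix u v \<longleftrightarrow> prefix (f u) (f v))"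

definition rist :: "('a, 'b) monoid_scheme \<Rightarrow> (nat \<Rightarrow> nat) \<Rightarrow> ('a \<Rightarrow> nat list \<Rightarrow> nat list)
    \<Rightarrow> nat list \<Rightarrow> 'a set" where
  "rist G k \<phi> v = {g \<in> carrier G. \<forall>w \<in> sh_tree k. \<not> prefix v w \<longrightarrow> \<phi> g w = w}"

definition rist_level :: "('a, 'b) monoid_scheme \<Rightarrow> (nat \<Rightarrow> nat) \<Rightarrow> ('a \<Rightarrow> nat list \<Rightarrow> nat list)
    \<Rightarrow> nat \<Rightarrow> 'a set" where
  "rist_level G k \<phi> n = generate G (\<Union>v \<in> tree_level k n. rist G k \<phi> v)"

definition branch_action :: "('a, 'b) monoid_scheme \<Rightarrow> (nat \<Rightarrow> nat) \<Rightarrow> ('a \<Rightarrow> nat list \<Rightarrow> nat list) \<Rightarrow> bool" where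
  "branch_action G k \<phi> \<longleftrightarrow>
     (\<forall>n. k n \<ge> 2) \<and>
     group_action G (sh_tree k) \<phi> \<and>
     (\<forall>g \<in> carrier G. tree_aut k (\<phi> g)) \<and>
     inj_on \<phi> (carrier G) \<and>
     (\<forall>n. \<forall>u \<in> tree_level k n. \<forall>v \<in> tree_level k n. \<exists>g \<in> carrier G. \<phi> g u = v) \<and>
     (\<forall>n. finite (rcosets\<^bsub>G\<^esub> (rist_level G k \<phi> n)))"

definition branch_group :: "('a, 'b) monoid_scheme \<Rightarrow> bool" where
  "branch_group G \<longleftrightarrow> group G \<and> (\<exists>k \<phi>. branch_action G k \<phi>)"

definition fin_gen_subgroup :: "('a, 'b) monoid_scheme \<Rightarrow> 'a set \<Rightarrow> bool" where
  "fin_gen_subgroup G H \<longleftrightarrow> (\<exists>S. finite S \<and> S \<subseteq> H \<and> generate G S = H)"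

definition fin_gen_group :: "('a, 'b) monoid_scheme \<Rightarrow> bool" where
  "fin_gen_group G \<longleftrightarrow> fin_gen_subgroup G (carrier G)"

definition centraliser :: "('a, 'b) monoid_scheme \<Rightarrow> 'a \<Rightarrow> 'a set" where
  "centraliser G a = {g \<in> carrier G. g \<otimes>\<^bsub>G\<^esub> a = a \<otimes>\<^bsub>G\<^esub> g}"

text \<open>n-configurations: maps from nonempty subsets of [n] to {0,1}
  (values outside that domain are irrelevant).\<close>
definition configuration :: "nat \<Rightarrow> (nat set \<Rightarrow> nat) \<Rightarrow> bool" where
  "configuration n c \<longleftrightarrow> (\<forall>I. I \<subseteq> {1..n} \<and> I \<noteq> {} \<longrightarrow> c I \<in> {0, 1})"

definition realisable :: "('a, 'b) monoid_scheme \<Rightarrow> nat \<Rightarrow> (nat set \<Rightarrow> nat) \<Rightarrow> bool" where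
  "realisable G n c \<longleftrightarrow>
     (\<exists>H :: nat \<Rightarrow> 'a set. (\<forall>i \<in> {1..n}. subgroup (H i) G) \<and>
        (\<forall>I. I \<subseteq> {1..n} \<and> I \<noteq> {} \<longrightarrow>
             (fin_gen_subgroup G (\<Inter>i \<in> I. H i) \<longleftrightarrow> c I = 0)))"

definition intersection_saturated :: "('a, 'b) monoid_scheme \<Rightarrow> bool" where
  "intersection_saturated G \<longleftrightarrow> (\<forall>n \<ge> 1. \<forall>c. configuration n c \<longrightarrow> realisable G n c)"

end

theory Submission
  imports Defs
begin

text \<open>
  Configurations are realised in a power of a finitely generated group \<open>R\<close> with an endomorphism \<open>\<theta>\<close>
  whose fixed-point subgroup is not finitely generated. The \<open>n\<close> conditions \<open>g\<^sub>i = g\<^sub>i\<^sub>+\<^sub>1\<close> for \<open>i < n\<close> and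
  \<open>g\<^sub>n = \<theta> (g\<^sub>1)\<close> together cut out a copy of the fixed points of \<open>\<theta>\<close> in \<open>R\<^sup>n\<close>, while any proper
  subset of them breaks the cycle and leaves a power of \<open>R\<close>. One such cycle for every \<open>I\<close> with
  \<open>c I \<noteq> 0\<close> realises \<open>c\<close>.

  In a branch group, \<open>R\<close> is the rigid stabiliser of a vertex \<open>v\<close> of a deep level: its conjugates at that
  level generate their direct product, of finite index, so \<open>R\<close> is finitely generated and large powers
  of \<open>R\<close> embed. The centraliser of \<open>\<alpha>\<close> in this product splits along the \<open>\<alpha>\<close>-orbits on the level,
  the factor of the orbit of \<open>v\<close> being the centraliser in \<open>R\<close> of the first power of \<open>\<alpha>\<close> that fixes \<open>v\<close>.
  Hence for some \<open>v\<close> this centraliser is not finitely generated, and \<open>\<theta>\<close> is conjugation by that power.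
\<close>

section \<open>Finite generation of subgroups\<close>

lemma fin_gen_subgroup_hom_image:
  assumes "group_hom G H h" "K \<subseteq> carrier G" "fin_gen_subgroup G K"
  shows "fin_gen_subgroup H (h ` K)"
proof -
  obtain S where S: "finite S" "S \<subseteq> K" "generate G S = K"
    using assms(3) by (auto simp: fin_gen_subgroup_def)
  have "generate H (h ` S) = h ` K"
    using group_hom.generate_img[OF assms(1), of S] S assms(2) by auto
  then show ?thesis
    unfolding fin_gen_subgroup_def using S by (intro exI[of _ "h ` S"]) auto
qed

text \<open>Generators of the image lift to finitely many elements of \<open>K\<close>. The subgroup
  they generate has the same image as \<open>K\<close>, hence equals \<open>K\<close> by
  injectivity.\<close>

lemma fin_gen_subgroup_inj_image_iff:
  assumes "group_hom G H h" "inj_on h (carrier G)" "K \<subseteq> carrier G"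
  shows "fin_gen_subgroup H (h ` K) \<longleftrightarrow> fin_gen_subgroup G K"
proof
  assume "fin_gen_subgroup H (h ` K)"
  then obtain S where S: "finite S" "S \<subseteq> h ` K" "generate H S = h ` K"
    by (auto simp: fin_gen_subgroup_def)
  then obtain S' where S': "S' \<subseteq> K" "finite S'" "S = h ` S'"
    by (meson finite_subset_image)
  interpret group_hom G H h by (rule assms)
  have "h ` generate G S' = h ` K"
    using generate_img[of S'] S S' assms(3) by auto
  moreover have "generate G S' \<subseteq> carrier G"
    using S' assms(3) G.generate_incl by blast
  ultimately have "generate G S' = K"
    using assms(2,3) inj_on_image_eq_iff by blast
  then show "fin_gen_subgroup G K"
    unfolding fin_gen_subgroup_def using S' by blast
qed (rule fin_gen_subgroup_hom_image[OF assms(1,3)])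

lemma (in group) fin_gen_subgroup_consistent:
  assumes "subgroup H G" "K \<subseteq> H"
  shows "fin_gen_subgroup (G\<lparr>carrier := H\<rparr>) K \<longleftrightarrow> fin_gen_subgroup G K"
  unfolding fin_gen_subgroup_def
  using generate_consistent[OF _ assms(1)] assms(2)
  by (metis (no_types, lifting) order_trans)

lemma (in group) fin_gen_subgroup_UN:
  assumes "finite I" "\<And>i. i \<in> I \<Longrightarrow> K i \<subseteq> carrier G"
    "\<And>i. i \<in> I \<Longrightarrow> fin_gen_subgroup G (K i)"
  shows "fin_gen_subgroup G (generate G (\<Union>i\<in>I. K i))"
proof -
  obtain S where S: "\<And>i. i \<in> I \<Longrightarrow> finite (S i) \<and> S i \<subseteq> K i \<and> generate G (S i) = K i"
    using assms(3) unfolding fin_gen_subgroup_def by metis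
  have carr: "(\<Union>i\<in>I. S i) \<subseteq> carrier G"
    using S assms(2) by blast
  have "K i \<subseteq> generate G (\<Union>i\<in>I. S i)" if "i \<in> I" for i
    using mono_generate[of "S i" "\<Union>i\<in>I. S i"] S[OF that] that by blast
  then have "generate G (\<Union>i\<in>I. K i) \<subseteq> generate G (\<Union>i\<in>I. S i)"
    by (intro generate_subgroup_incl generate_is_subgroup carr) auto
  moreover have "generate G (\<Union>i\<in>I. S i) \<subseteq> generate G (\<Union>i\<in>I. K i)"
    using S by (intro mono_generate) blast
  ultimately have "generate G (\<Union>i\<in>I. S i) = generate G (\<Union>i\<in>I. K i)" by auto
  moreover have "(\<Union>i\<in>I. S i) \<subseteq> generate G (\<Union>i\<in>I. K i)"
    using S by (auto intro: generate.incl)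
  ultimately show ?thesis
    unfolding fin_gen_subgroup_def using S assms(1)
    by (intro exI[of _ "\<Union>i\<in>I. S i"]) auto
qed

text \<open>One representative is taken from \<open>C\<close> itself for each coset of
  \<open>H\<close> that meets \<open>C\<close>. When \<open>C\<close> is a subgroup, this choice
  puts the factor \<open>h\<close> of \<open>x = h \<otimes> t\<close> into \<open>C\<close> as
  well.\<close>

lemma (in group) finite_right_transversal:
  assumes "subgroup H G" "finite (rcosets H)" "C \<subseteq> carrier G"
  obtains T where "finite T" "T \<subseteq> C" "\<And>x. x \<in> C \<Longrightarrow> \<exists>h\<in>H. \<exists>t\<in>T. x = h \<otimes> t"
proof -
  interpret subgroup H G by (rule assms(1))
  have "finite ((\<lambda>x. H #> x) ` C)"
    by (rule finite_subset[OF _ assms(2)]) (use assms(3) in \<open>auto simp: RCOSETS_def\<close>)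
  then obtain T where T: "T \<subseteq> C" "finite T" "(\<lambda>x. H #> x) ` C = (\<lambda>x. H #> x) ` T"
    by (metis (no_types) finite_subset_image subset_refl)
  show ?thesis
  proof (rule that[OF T(2,1)])
    fix x assume x: "x \<in> C"
    then obtain t where t: "t \<in> T" "H #> x = H #> t" using T(3) by blast
    have "x \<in> H #> x"
      using x assms(3) one_closed by (auto simp: r_coset_def intro!: bexI[of _ \<one>])
    then have "x \<in> H #> t" using t(2) by simp
    then show "\<exists>h\<in>H. \<exists>t\<in>T. x = h \<otimes> t"
      using t(1) by (auto simp: r_coset_def)
  qed
qed

text \<open>Schreier's lemma; no normalised transversal is needed because the representatives
  lying in \<open>H\<close> are added to the generators.\<close>

lemma (in group) fin_gen_subgroup_finite_index:
  assumes "fin_gen_group G" "subgroup H G" "finite (rcosets H)"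
  shows "fin_gen_subgroup G H"
proof -
  interpret H: subgroup H G by (rule assms(2))
  obtain S where S: "finite S" "S \<subseteq> carrier G" "generate G S = carrier G"
    using assms(1) by (auto simp: fin_gen_group_def fin_gen_subgroup_def)
  obtain T where T: "finite T" "T \<subseteq> carrier G"
    "\<And>x. x \<in> carrier G \<Longrightarrow> \<exists>h\<in>H. \<exists>t\<in>T. x = h \<otimes> t"
    using finite_right_transversal[OF assms(2,3) subset_refl] by metis
  \<comment> \<open>Adding the inverses turns membership in \<open>generate G S\<close> into right
    multiplication by elements of \<open>S'\<close> alone.\<close>
  define S' where "S' = S \<union> m_inv G ` S"
  \<comment> \<open>All products \<open>t \<otimes> s \<otimes> inv t'\<close> that happen to lie in
    \<open>H\<close> are taken, so \<open>t'\<close> need not be singled out as the representative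
    of \<open>t \<otimes> s\<close>.\<close>
  define U where "U = ((\<lambda>(t, s, t'). t \<otimes> s \<otimes> inv t') ` (T \<times> S' \<times> T) \<inter> H) \<union> (T \<inter> H)"
  have S'c: "S' \<subseteq> carrier G" using S(2) by (auto simp: S'_def)
  have Uc: "U \<subseteq> carrier G" and UH: "U \<subseteq> H" by (auto simp: U_def)
  have finU: "finite U" using T(1) S(1) by (auto simp: U_def S'_def)
  have Usub: "subgroup (generate G U) G" by (rule generate_is_subgroup[OF Uc])
  interpret U: subgroup "generate G U" G by (rule Usub)
  \<comment> \<open>The set \<open>M\<close> contains \<open>\<one>\<close> and is stable under
    right multiplication by generators, so it is the whole group.\<close>
  define M where "M = {u \<otimes> t | u t. u \<in> generate G U \<and> t \<in> T}"
  have step: "m \<otimes> s \<in> M" if m: "m \<in> M" and s: "s \<in> S'" for m s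
  proof -
    obtain u t where ut: "u \<in> generate G U" "t \<in> T" "m = u \<otimes> t" using m by (auto simp: M_def)
    have c: "t \<in> carrier G" "s \<in> carrier G" "u \<in> carrier G"
      using ut T(2) s S'c by auto
    obtain h t' where ht: "h \<in> H" "t' \<in> T" "t \<otimes> s = h \<otimes> t'"
      using T(3)[of "t \<otimes> s"] c by auto
    have t'c: "t' \<in> carrier G" "h \<in> carrier G" using ht T(2) by auto
    have "h = t \<otimes> s \<otimes> inv t'" using ht t'c c by (metis inv_solve_right m_closed)
    then have "h \<in> U" unfolding U_def using ht ut s
      by (auto intro!: image_eqI[of _ _ "(t, s, t')"])
    then have "u \<otimes> h \<in> generate G U" using ut by (auto intro: generate.incl)
    moreover have "m \<otimes> s = (u \<otimes> h) \<otimes> t'"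
      using ht(3) ut c t'c by (simp add: m_assoc)
    ultimately show ?thesis using ht unfolding M_def by blast
  qed
  have "m \<otimes> x \<in> M" if "x \<in> generate G S" "m \<in> M" for m x
    using that
  proof (induction x arbitrary: m rule: generate.induct)
    case one
    moreover have "m \<in> carrier G" using one.prems T(2) U.subset by (auto simp: M_def)
    ultimately show ?case by simp
  next
    case (incl h) then show ?case using step by (simp add: S'_def)
  next
    case (inv h) then show ?case using step by (simp add: S'_def)
  next
    case (eng h1 h2)
    have "m \<in> carrier G" using eng.prems T(2) U.subset by (auto simp: M_def)
    moreover have "h1 \<in> carrier G" "h2 \<in> carrier G" using eng.hyps S(3) by auto
    ultimately show ?case using eng.IH eng.prems by (simp flip: m_assoc)
  qed
  \<comment> \<open>The representative of the coset \<open>H\<close> lies in \<open>H\<close>, hence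
    in the second part of \<open>U\<close>, and can be cancelled.\<close>
  moreover have "\<one> \<in> M"
  proof -
    obtain h t where ht: "h \<in> H" "t \<in> T" "\<one> = h \<otimes> t" using T(3)[of \<one>] by auto
    have c: "t \<in> carrier G" "h \<in> carrier G" using ht T(2) by auto
    have "t = inv h" using ht(3) c by (metis inv_equality inv_inv)
    then have "t \<in> U" using ht by (auto simp: U_def)
    then have "inv t \<in> generate G U" by (rule generate.inv)
    moreover have "inv t \<otimes> t = \<one>" using c by simp
    ultimately show ?thesis unfolding M_def using ht(2) by force
  qed
  ultimately have GM: "x \<in> M" if "x \<in> carrier G" for x
    using that S(3) by (metis l_one)
  have "H \<subseteq> generate G U"
  proof
    fix h assume h: "h \<in> H"
    then obtain u t where ut: "u \<in> generate G U" "t \<in> T" "h = u \<otimes> t"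
      using GM[of h] by (auto simp: M_def)
    have uH: "u \<in> H" using generate_subgroup_incl[OF UH assms(2)] ut by auto
    have "t = inv u \<otimes> h" using ut T(2) U.subset by (metis inv_solve_left' subsetD H.mem_carrier h)
    then have "t \<in> H" using uH h by simp
    then have "t \<in> U" using ut(2) by (simp add: U_def)
    then show "h \<in> generate G U" using ut by (auto intro: generate.incl)
  qed
  then have "generate G U = H" using generate_subgroup_incl[OF UH assms(2)] by auto
  then show ?thesis using finU UH unfolding fin_gen_subgroup_def by blast
qed

text \<open>The intersection has finite index in \<open>C\<close>: generators of
  \<open>C \<inter> H\<close> together with coset representatives chosen in \<open>C\<close>
  generate \<open>C\<close>.\<close>

lemma (in group) fin_gen_subgroup_if_Int_finite_index:
  assumes "subgroup C G" "subgroup H G" "finite (rcosets H)"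
    "fin_gen_subgroup G (C \<inter> H)"
  shows "fin_gen_subgroup G C"
proof -
  interpret C: subgroup C G by (rule assms(1))
  interpret H: subgroup H G by (rule assms(2))
  obtain T where T: "finite T" "T \<subseteq> C" "\<And>x. x \<in> C \<Longrightarrow> \<exists>h\<in>H. \<exists>t\<in>T. x = h \<otimes> t"
    using finite_right_transversal[OF assms(2,3) C.subset] by metis
  obtain S where S: "finite S" "S \<subseteq> C \<inter> H" "generate G S = C \<inter> H"
    using assms(4) by (auto simp: fin_gen_subgroup_def)
  have "C \<subseteq> generate G (S \<union> T)"
  proof
    fix x assume x: "x \<in> C"
    then obtain h t where ht: "h \<in> H" "t \<in> T" "x = h \<otimes> t" using T(3) by blast
    have "h = x \<otimes> inv t" using ht T(2) by (metis inv_solve_right' C.mem_carrier H.mem_carrier subsetD x)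
    moreover have "t \<in> C" using ht T(2) by auto
    ultimately have "h \<in> C \<inter> H" using ht(1) x by (metis C.m_closed C.m_inv_closed IntI)
    then have "h \<in> generate G (S \<union> T)" using S(3) mono_generate[of S "S \<union> T"] by auto
    then show "x \<in> generate G (S \<union> T)"
      unfolding ht(3) using ht(2) by (auto intro: generate.eng generate.incl)
  qed
  moreover have "S \<union> T \<subseteq> C" using S T by auto
  ultimately have "generate G (S \<union> T) = C"
    using generate_subgroup_incl[OF _ assms(1), of "S \<union> T"] by blast
  then show ?thesis unfolding fin_gen_subgroup_def using S(1) T(1) \<open>S \<union> T \<subseteq> C\<close>
    by (intro exI[of _ "S \<union> T"]) auto
qed

section \<open>Direct products of groups\<close>

lemma group_hom_product_inclusion:
  assumes "\<And>y. y \<in> Ix \<Longrightarrow> group (R y)" "x \<in> Ix"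
  shows "group_hom (R x) (product_group Ix R) (\<lambda>r. \<lambda>y\<in>Ix. if y = x then r else \<one>\<^bsub>R y\<^esub>)"
proof -
  have one: "\<one>\<^bsub>R y\<^esub> \<in> carrier (R y)" if "y \<in> Ix" for y
    using assms(1)[OF that] by (intro monoid.one_closed group.is_monoid)
  have "(\<lambda>r. \<lambda>y\<in>Ix. if y = x then r else \<one>\<^bsub>R y\<^esub>) \<in> hom (R x) (product_group Ix R)"
  proof (rule homI)
    fix r assume "r \<in> carrier (R x)"
    then show "(\<lambda>y\<in>Ix. if y = x then r else \<one>\<^bsub>R y\<^esub>) \<in> carrier (product_group Ix R)"
      using one by (auto simp: PiE_iff)
  qed (use assms one in \<open>auto simp: fun_eq_iff group.is_monoid\<close>)
  then show ?thesis
    using assms by (simp add: group_hom_def group_hom_axioms_def)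
qed

lemma fin_gen_product_group:
  assumes fin: "finite Ix" and grp: "\<And>x. x \<in> Ix \<Longrightarrow> group (R x)"
    and fg: "\<And>x. x \<in> Ix \<Longrightarrow> fin_gen_group (R x)"
  shows "fin_gen_group (product_group Ix R)"
proof -
  let ?P = "product_group Ix R"
  let ?inc = "\<lambda>x r. \<lambda>y\<in>Ix. if y = x then r else \<one>\<^bsub>R y\<^esub>"
  interpret P: group ?P using grp by simp
  define K where "K x = ?inc x ` carrier (R x)" for x
  have hom: "group_hom (R x) ?P (?inc x)" if "x \<in> Ix" for x
    by (rule group_hom_product_inclusion[OF grp that])
  have Kc: "K x \<subseteq> carrier ?P" if "x \<in> Ix" for x
    using group_hom.hom_closed[OF hom[OF that]] unfolding K_def by blast
  have "fin_gen_subgroup ?P (K x)" if "x \<in> Ix" for x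
    unfolding K_def using fg[OF that]
    by (intro fin_gen_subgroup_hom_image[OF hom[OF that]]) (auto simp: fin_gen_group_def)
  then have "fin_gen_subgroup ?P (generate ?P (\<Union>x\<in>Ix. K x))"
    by (intro P.fin_gen_subgroup_UN fin Kc)
  \<comment> \<open>Induction over a finite set \<open>Y\<close> outside which \<open>g\<close> is
    trivial; each step splits off one coordinate as an element of some \<open>K z\<close>.\<close>
  moreover have gen: "g \<in> generate ?P (\<Union>x\<in>Ix. K x)"
    if "finite Y" "Y \<subseteq> Ix" "g \<in> carrier ?P" "\<And>x. x \<in> Ix - Y \<Longrightarrow> g x = \<one>\<^bsub>R x\<^esub>" for Y g
    using that
  proof (induction Y arbitrary: g rule: finite_induct)
    case empty
    then have "g = \<one>\<^bsub>?P\<^esub>" by (auto simp: PiE_iff extensional_def)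
    then show ?case by (metis generate.one)
  next
    case (insert z Y)
    define g' where "g' = g(z := \<one>\<^bsub>R z\<^esub>)"
    have z: "z \<in> Ix" using insert by auto
    have g'c: "g' \<in> carrier ?P"
      using insert.prems(2) z grp
      by (auto simp: g'_def PiE_iff extensional_def group.is_monoid monoid.one_closed)
    have "g' \<in> generate ?P (\<Union>x\<in>Ix. K x)"
      using insert.prems insert.hyps by (intro insert.IH g'c) (auto simp: g'_def)
    moreover have "?inc z (g z) \<in> K z" using insert.prems z by (auto simp: K_def)
    then have "?inc z (g z) \<in> generate ?P (\<Union>x\<in>Ix. K x)" using z by (auto intro: generate.incl)
    moreover have "?inc z (g z) \<otimes>\<^bsub>?P\<^esub> g' = g"
    proof
      fix y show "(?inc z (g z) \<otimes>\<^bsub>?P\<^esub> g') y = g y"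
        using insert.prems(2) grp[of y]
        by (auto simp: g'_def PiE_iff extensional_def group.is_monoid)
    qed
    ultimately show ?case by (metis generate.eng)
  qed
  have "generate ?P (\<Union>x\<in>Ix. K x) = carrier ?P"
  proof
    show "generate ?P (\<Union>x\<in>Ix. K x) \<subseteq> carrier ?P"
      by (rule P.generate_incl) (use Kc in blast)
    show "carrier ?P \<subseteq> generate ?P (\<Union>x\<in>Ix. K x)"
      using gen[OF fin subset_refl] by blast
  qed
  ultimately show ?thesis by (simp add: fin_gen_group_def)
qed

section \<open>Realising configurations in powers of a group\<close>

lemma (in group) subgroup_fixed_points:
  assumes "F \<in> hom G G"
  shows "subgroup {g \<in> carrier G. F g = g} G"
proof -
  interpret F: group_hom G G F by standard (rule assms)
  show ?thesis by (rule subgroupI) auto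
qed

text \<open>The power \<open>F ^^ m\<close> retracts the group onto the fixed points of
  \<open>F\<close>: its values are fixed by \<open>F\<close>, and it is the identity on fixed
  points. They thus form a homomorphic image of a finitely generated group.\<close>

lemma (in group) fin_gen_fixed_points:
  assumes "fin_gen_group G" "F \<in> hom G G"
    "\<And>g. g \<in> carrier G \<Longrightarrow> (F ^^ Suc m) g = (F ^^ m) g"
  shows "fin_gen_subgroup G {g \<in> carrier G. F g = g}"
proof -
  have hom: "F ^^ k \<in> hom G G" for k
  proof (induction k)
    case 0
    then show ?case by (simp add: hom_def)
  next
    case (Suc k)
    then show ?case using assms(2) by (auto simp: hom_def Pi_iff)
  qed
  interpret Fm: group_hom G G "F ^^ m" by standard (rule hom)
  have fixed: "(F ^^ k) g = g" if "F g = g" for k g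
    by (induction k) (use that in auto)
  have "(F ^^ m) ` carrier G = {g \<in> carrier G. F g = g}"
    using assms(3) fixed by (auto intro!: image_eqI[of _ "F ^^ m"])
  moreover have "fin_gen_subgroup G ((F ^^ m) ` carrier G)"
    using assms(1) by (intro fin_gen_subgroup_hom_image[OF Fm.group_hom_axioms])
      (auto simp: fin_gen_group_def)
  ultimately show ?thesis by simp
qed

text \<open>An injective homomorphism commutes with intersections over non-empty sets and preserves
  and reflects finite generation, so the images of the subgroups serve as witnesses.\<close>

lemma realisable_mono:
  assumes "group_hom A G h" "inj_on h (carrier A)" "realisable A n c"
  shows "realisable G n c"
proof -
  interpret group_hom A G h by (rule assms)
  obtain H where H: "\<And>i. i \<in> {1..n} \<Longrightarrow> subgroup (H i) A"
    and fg: "\<And>I. I \<subseteq> {1..n} \<Longrightarrow> I \<noteq> {} \<Longrightarrow> fin_gen_subgroup A (\<Inter>i\<in>I. H i) \<longleftrightarrow> c I = 0"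
    using assms(3) unfolding realisable_def by metis
  have sub: "H i \<subseteq> carrier A" if "i \<in> {1..n}" for i
    using subgroup.subset[OF H[OF that]] .
  have "fin_gen_subgroup G (\<Inter>i\<in>I. h ` H i) \<longleftrightarrow> c I = 0" if I: "I \<subseteq> {1..n}" "I \<noteq> {}" for I
  proof -
    obtain j where j: "j \<in> I" using I by auto
    have "(\<Inter>i\<in>I. h ` H i) = h ` (\<Inter>i\<in>I. H i)"
      using image_INT[OF assms(2) _ j, of H] sub I by blast
    moreover have "(\<Inter>i\<in>I. H i) \<subseteq> carrier A" using sub I j by blast
    ultimately show ?thesis
      using fin_gen_subgroup_inj_image_iff[OF assms(1,2)] fg[OF I] by simp
  qed
  moreover have "subgroup (h ` H i) G" if "i \<in> {1..n}" for i
    using subgroup_img_is_subgroup[OF H[OF that]] .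
  ultimately show ?thesis unfolding realisable_def by (intro exI[of _ "\<lambda>i. h ` H i"]) simp
qed

text \<open>The pair \<open>(I, i)\<close> is the \<open>i\<close>-th coordinate of the cycle belonging to \<open>I\<close>. In that cycle the
  conditions at indices outside \<open>I\<close> are imposed by every \<open>H\<^sub>j\<close> with \<open>j \<in> I\<close>, and \<open>H\<^sub>j\<close> with \<open>j \<notin> I\<close> is
  trivial there. The intersection over \<open>J\<close> consists of the fixed points of \<open>F J\<close>, and if the cycles
  are all broken then iterating \<open>F J\<close> retracts the whole power onto them.\<close>

lemma realisable_power:
  fixes R :: "('a, 'b) monoid_scheme" and n :: nat and c :: "nat set \<Rightarrow> nat"
  defines "Ix \<equiv> {I. I \<subseteq> {1..n} \<and> I \<noteq> {} \<and> c I \<noteq> 0} \<times> {1..n}"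
  assumes "group R" "fin_gen_group R" "\<theta> \<in> hom R R"
    and nfg: "\<not> fin_gen_subgroup R {h \<in> carrier R. \<theta> h = h}"
  shows "realisable (product_group Ix (\<lambda>_. R)) n c"
proof -
  let ?P = "product_group Ix (\<lambda>_. R)"
  interpret R: group R by fact
  interpret P: group ?P by (rule product_group) (rule R.group_axioms)
  interpret \<theta>: group_hom R R \<theta> by standard fact
  \<comment> \<open>The twist \<open>\<theta>\<close> enters a cycle once, at the passage from
    \<open>n\<close> back to \<open>1\<close>; all other conditions are plain equalities.\<close>
  define t where "t i = (if i = n then \<theta> else id)" for i
  define nx where "nx i = (if i = n then 1 else Suc i)" for i
  \<comment> \<open>The last branch is reached exactly at \<open>i \<in> I - J\<close>. There the
    entry is left free, and the cycle is broken.\<close>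
  define F where "F J g = (\<lambda>(I, i) \<in> Ix. if \<not> J \<subseteq> I then \<one>\<^bsub>R\<^esub> else
    if i \<in> J \<or> i \<notin> I then t i (g (I, nx i)) else g (I, i))" for J g
  define K where "K J = {g \<in> carrier ?P. F J g = g}" for J
  have finIx: "finite Ix"
    unfolding Ix_def by (rule finite_cartesian_product) (auto intro: rev_finite_subset[of "Pow {1..n}"])
  have fgP: "fin_gen_group ?P"
    by (rule fin_gen_product_group[OF finIx]) (rule assms)+
  have t_closed: "t i h \<in> carrier R" if "h \<in> carrier R" for i h
    using that by (simp add: t_def)
  have t_one: "t i \<one>\<^bsub>R\<^esub> = \<one>\<^bsub>R\<^esub>" for i by (simp add: t_def)
  have t_mult: "t i (a \<otimes>\<^bsub>R\<^esub> b) = t i a \<otimes>\<^bsub>R\<^esub> t i b" if "a \<in> carrier R" "b \<in> carrier R" for i a b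
    using that by (simp add: t_def)
  have nx: "(I, nx i) \<in> Ix" if "(I, i) \<in> Ix" for I i
    using that by (auto simp: Ix_def nx_def)
  have g_closed: "g (I, i) \<in> carrier R" if "g \<in> carrier ?P" "(I, i) \<in> Ix" for g I i
    using that by (auto simp: PiE_iff)
  have F_hom: "F J \<in> hom ?P ?P" for J
  proof (rule homI)
    fix g assume g: "g \<in> carrier ?P"
    show "F J g \<in> carrier ?P"
      using g_closed[OF g] nx by (auto simp: F_def PiE_iff intro!: t_closed)
    fix g' assume g': "g' \<in> carrier ?P"
    show "F J (g \<otimes>\<^bsub>?P\<^esub> g') = F J g \<otimes>\<^bsub>?P\<^esub> F J g'"
      using g_closed[OF g] g_closed[OF g'] nx
      by (auto simp: F_def fun_eq_iff t_mult)
  qed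
  have K_iff: "g \<in> K J \<longleftrightarrow> g \<in> carrier ?P \<and> (\<forall>I i. (I, i) \<in> Ix \<longrightarrow>
      (\<not> J \<subseteq> I \<longrightarrow> g (I, i) = \<one>\<^bsub>R\<^esub>) \<and>
      (J \<subseteq> I \<longrightarrow> i \<in> J \<or> i \<notin> I \<longrightarrow> g (I, i) = t i (g (I, nx i))))" for g J
  proof -
    have ext: "F J g = g" if "g \<in> carrier ?P" "\<And>I i. (I, i) \<in> Ix \<Longrightarrow> F J g (I, i) = g (I, i)"
      using that by (intro extensionalityI[of _ Ix]) (auto simp: F_def PiE_iff)
    have "F J g (I, i) = g (I, i) \<longleftrightarrow> (\<not> J \<subseteq> I \<longrightarrow> g (I, i) = \<one>\<^bsub>R\<^esub>) \<and>
        (J \<subseteq> I \<longrightarrow> i \<in> J \<or> i \<notin> I \<longrightarrow> g (I, i) = t i (g (I, nx i)))" if "(I, i) \<in> Ix" for I i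
      using that by (cases "J \<subseteq> I") (auto simp: F_def)
    with ext show ?thesis unfolding K_def by (metis (mono_tags, lifting) mem_Collect_eq)
  qed
  have Inter_K: "(\<Inter>j\<in>J. K {j}) = K J" if J: "J \<subseteq> {1..n}" "J \<noteq> {}" for J
  proof (intro equalityI subsetI)
    fix g assume g: "g \<in> K J"
    have "g \<in> K {j}" if j: "j \<in> J" for j
      unfolding K_iff
    proof (intro conjI allI impI)
      show "g \<in> carrier ?P" using g by (simp add: K_def)
      fix I i assume i: "(I, i) \<in> Ix"
      show "g (I, i) = \<one>\<^bsub>R\<^esub>" if "\<not> {j} \<subseteq> I"
        using g i that j unfolding K_iff by blast
      show "g (I, i) = t i (g (I, nx i))" if "{j} \<subseteq> I" "i \<in> {j} \<or> i \<notin> I"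
      proof (cases "J \<subseteq> I")
        case True
        then show ?thesis using g i that j unfolding K_iff by blast
      next
        \<comment> \<open>An index of \<open>J\<close> outside \<open>I\<close> forces every entry
          of this cycle to be trivial, and the equation reads
          \<open>\<one> = t i \<one>\<close>.\<close>
        case False
        then show ?thesis using g i nx[OF i] t_one unfolding K_iff by metis
      qed
    qed
    then show "g \<in> (\<Inter>j\<in>J. K {j})" by blast
  next
    fix g assume g: "g \<in> (\<Inter>j\<in>J. K {j})"
    then have gj: "g \<in> K {j}" if "j \<in> J" for j using that by blast
    show "g \<in> K J"
      unfolding K_iff
    proof (intro conjI allI impI)
      show "g \<in> carrier ?P" using gj J by (auto simp: K_def)
      fix I i assume i: "(I, i) \<in> Ix"
      show "g (I, i) = \<one>\<^bsub>R\<^esub>" if "\<not> J \<subseteq> I"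
        using gj i that unfolding K_iff by blast
      show "g (I, i) = t i (g (I, nx i))" if "J \<subseteq> I" "i \<in> J \<or> i \<notin> I"
        using gj i that J unfolding K_iff by blast
    qed
  qed
  have fg: "fin_gen_subgroup ?P (K J)" if J: "J \<subseteq> {1..n}" "J \<noteq> {}" "c J = 0" for J
    unfolding K_def
  proof (rule P.fin_gen_fixed_points[OF fgP F_hom])
    fix g assume "g \<in> carrier ?P"
    \<comment> \<open>In the cycles of sets \<open>I\<close> that do not contain \<open>J\<close>,
      the iterates of \<open>F J\<close> are trivial only from the first one on.\<close>
    have n: "n > 0" using J by (cases n) auto
    \<comment> \<open>The rank is the number of steps along the cycle from \<open>i\<close> to the break \<open>r\<close>.\<close>
    have stable: "(F J ^^ Suc m) g (I, i) = (F J ^^ m) g (I, i)"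
      if I: "(I, i) \<in> Ix" "J \<subseteq> I" and r: "r \<in> I" "r \<notin> J"
        and rank: "(if i \<le> r then r - i else r + n - i) \<le> m" for I i r m
      using I(1) rank
    proof (induction m arbitrary: i)
      case 0
      then have "r \<in> {1..n}" using r by (auto simp: Ix_def)
      \<comment> \<open>For \<open>i > r\<close> the rank \<open>r + n - i\<close> is at least
        \<open>r\<close>, hence positive; so rank 0 occurs only at the break itself.\<close>
      then have "i = r" using 0 by (auto simp: Ix_def split: if_splits)
      then show ?case using 0 I(2) r by (simp add: F_def)
    next
      case (Suc m)
      have r': "r \<in> {1..n}" using Suc.prems r by (auto simp: Ix_def)
      show ?case
      proof (cases "i \<in> J \<or> i \<notin> I")
        case False
        then show ?thesis using Suc.prems I(2) by (simp add: F_def)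
      next
        case True
        then have "i \<noteq> r" using r by blast
        \<comment> \<open>A step along the cycle lowers the rank by one, also from \<open>n\<close>
          to \<open>1\<close>, where it drops from \<open>r\<close> to \<open>r - 1\<close>.\<close>
        then have "(if nx i \<le> r then r - nx i else r + n - nx i) \<le> m"
          using Suc.prems r' by (auto simp: nx_def Ix_def split: if_splits)
        then have "(F J ^^ Suc m) g (I, nx i) = (F J ^^ m) g (I, nx i)"
          using Suc.IH[OF nx[OF Suc.prems(1)]] by blast
        moreover have "(F J ^^ Suc k) g (I, i) = t i ((F J ^^ k) g (I, nx i))" for k
          using True I(2) Suc.prems(1) by (simp add: F_def)
        ultimately show ?thesis by metis
      qed
    qed
    show "(F J ^^ Suc n) g = (F J ^^ n) g"
    proof (rule extensionalityI[of _ Ix])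
      show "(F J ^^ Suc n) g \<in> extensional Ix" by (simp add: F_def)
      show "(F J ^^ n) g \<in> extensional Ix" using n by (cases n) (simp_all add: F_def)
      fix x assume x: "x \<in> Ix"
      obtain I i where Ii: "x = (I, i)" by (cases x)
      show "(F J ^^ Suc n) g x = (F J ^^ n) g x"
      proof (cases "J \<subseteq> I")
        case False
        then have "(F J ^^ Suc k) g x = \<one>\<^bsub>R\<^esub>" for k
          using x by (simp add: F_def Ii)
        then show ?thesis using n by (metis gr0_implies_Suc)
      next
        case True
        \<comment> \<open>Cycles exist only for sets with nonzero value, while
          \<open>c J = 0\<close>; the inclusion of \<open>J\<close> in \<open>I\<close> is therefore
          strict and leaves a break.\<close>
        have "I \<noteq> J" using J(3) x by (auto simp: Ii Ix_def)
        then obtain r where r: "r \<in> I" "r \<notin> J" using True by blast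
        have "(if i \<le> r then r - i else r + n - i) \<le> n"
          using r x by (auto simp: Ii Ix_def)
        then show ?thesis using stable[OF _ True r] x Ii by blast
      qed
    qed
  qed
  have not_fg: "\<not> fin_gen_subgroup ?P (K J)" if J: "J \<subseteq> {1..n}" "J \<noteq> {}" "c J \<noteq> 0" for J
  proof
    assume fgK: "fin_gen_subgroup ?P (K J)"
    have JI: "(J, i) \<in> Ix" if "1 \<le> i" "i \<le> n" for i
      using that J by (auto simp: Ix_def)
    have n: "1 \<le> n" using J by (cases n) auto
    have hom: "group_hom ?P R (\<lambda>g. g (J, 1))"
      using JI[of 1] n by unfold_locales (auto intro!: homI simp: PiE_iff)
    \<comment> \<open>The cycle of \<open>J\<close> itself has no break: its entries all agree, and
      closing it imposes \<open>\<theta> h = h\<close>. Conversely, a fixed point \<open>h\<close>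
      is the first entry of the family that is constantly \<open>h\<close> on this cycle and trivial
      elsewhere.\<close>
    have "(\<lambda>g. g (J, 1)) ` K J = {h \<in> carrier R. \<theta> h = h}"
    proof (intro equalityI subsetI)
      fix h assume "h \<in> (\<lambda>g. g (J, 1)) ` K J"
      then obtain g where g: "g \<in> K J" "h = g (J, 1)" by blast
      have eq: "g (J, i) = t i (g (J, nx i))" if "1 \<le> i" "i \<le> n" for i
        using g(1) JI[OF that] unfolding K_iff by blast
      have const: "g (J, Suc i) = g (J, 1)" if "i < n" for i
        using that
      proof (induction i)
        case (Suc i)
        then show ?case using eq[of "Suc i"] by (simp add: t_def nx_def)
      qed simp
      have "g (J, n) = \<theta> h" using eq[of n] n g(2) by (simp add: t_def nx_def)
      moreover have "g (J, n) = h" using const[of "n - 1"] n g(2) by simp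
      moreover have "h \<in> carrier R"
        using g JI[of 1] n g_closed[of g] unfolding K_def by blast
      ultimately show "h \<in> {h \<in> carrier R. \<theta> h = h}" by simp
    next
      fix h assume h: "h \<in> {h \<in> carrier R. \<theta> h = h}"
      define g where "g = (\<lambda>(I, i) \<in> Ix. if I = J then h else \<one>\<^bsub>R\<^esub>)"
      have "t i h = h" for i using h by (simp add: t_def)
      then have "g \<in> K J"
        unfolding K_iff using h nx t_one by (auto simp: g_def PiE_iff)
      moreover have "h = g (J, 1)" using JI[of 1] n by (simp add: g_def)
      ultimately show "h \<in> (\<lambda>g. g (J, 1)) ` K J" by blast
    qed
    moreover have "fin_gen_subgroup R ((\<lambda>g. g (J, 1)) ` K J)"
      by (intro fin_gen_subgroup_hom_image[OF hom _ fgK]) (auto simp: K_def)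
    ultimately show False using nfg by simp
  qed
  have "subgroup (K {i}) ?P" for i
    unfolding K_def by (rule P.subgroup_fixed_points[OF F_hom])
  then show ?thesis
    unfolding realisable_def using Inter_K fg not_fg
    by (intro exI[of _ "\<lambda>i. K {i}"]) (metis (no_types, lifting))
qed

section \<open>Rigid stabilisers of a tree action\<close>

lemma finite_tree_level: "finite (tree_level k n)"
proof (rule finite_subset)
  show "tree_level k n \<subseteq> {v. set v \<subseteq> (\<Union>i<n. {..<k i}) \<and> length v = n}"
    by (fastforce simp: tree_level_def sh_tree_def in_set_conv_nth)
  show "finite {v. set v \<subseteq> (\<Union>i<n. {..<k i}) \<and> length v = n}"
    by (rule finite_lists_length_eq) auto
qed

text \<open>Words over \<open>{0, 1}\<close> are vertices of every such tree. The bound supplies a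
  level with room for any prescribed number of coordinates.\<close>

lemma card_tree_level_ge:
  assumes "\<And>i. k i \<ge> 2"
  shows "2 ^ n \<le> card (tree_level k n)"
proof -
  have "{v. set v \<subseteq> {0, 1} \<and> length v = n} \<subseteq> tree_level k n"
  proof safe
    fix v :: "nat list" assume v: "set v \<subseteq> {0, 1}" "n = length v"
    have "v ! i < k i" if "i < length v" for i
    proof -
      have "v ! i \<in> {0, 1}" using v nth_mem[OF that] by blast
      then show ?thesis using assms[of i] by auto
    qed
    then show "v \<in> tree_level k (length v)" by (simp add: tree_level_def sh_tree_def)
  qed
  then have "card {v::nat list. set v \<subseteq> {0, 1} \<and> length v = n} \<le> card (tree_level k n)"
    by (rule card_mono[OF finite_tree_level])
  then show ?thesis using card_lists_length_eq[of "{0, 1::nat}" n] by (simp add: numeral_2_eq_2)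
qed

lemma prefix_in_sh_tree: "prefix u v \<Longrightarrow> v \<in> sh_tree k \<Longrightarrow> u \<in> sh_tree k"
  by (auto simp: sh_tree_def prefix_def nth_append) (metis trans_less_add1)

lemma tree_level_cases:
  assumes "w \<in> sh_tree k"
  obtains "length w < n" | v where "v \<in> tree_level k n" "prefix v w"
proof (cases "length w < n")
  case False
  then have "take n w \<in> tree_level k n"
    using prefix_in_sh_tree[OF take_is_prefix assms] by (simp add: tree_level_def)
  then show ?thesis using that(2) take_is_prefix by blast
qed (rule that(1))

lemma tree_level_prefix_unique:
  "u \<in> tree_level k n \<Longrightarrow> v \<in> tree_level k n \<Longrightarrow> prefix u w \<Longrightarrow> prefix v w \<Longrightarrow> u = v"
  by (auto simp: tree_level_def intro!: prefix_order.antisym intro: prefix_length_prefix[of _ w])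

section \<open>Faithful actions by tree automorphisms\<close>

locale tree_action = group_action G "sh_tree k" \<phi>
  for G :: "('a, 'b) monoid_scheme" (structure) and k :: "nat \<Rightarrow> nat" and \<phi> +
  assumes aut: "g \<in> carrier G \<Longrightarrow> tree_aut k (\<phi> g)"
    and faithful: "inj_on \<phi> (carrier G)"
begin

sublocale group G
  using group_hom by (rule group_hom.axioms)

abbreviation "T \<equiv> sh_tree k"
abbreviation "R \<equiv> rist G k \<phi>"
abbreviation "lev \<equiv> tree_level k"

definition conjugate :: "'a \<Rightarrow> 'a \<Rightarrow> 'a" where "conjugate g h = g \<otimes> h \<otimes> inv g"

lemma conjugate_closed [simp]: "g \<in> carrier G \<Longrightarrow> h \<in> carrier G \<Longrightarrow> conjugate g h \<in> carrier G"
  by (simp add: conjugate_def)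

lemma conjugate_one [simp]: "g \<in> carrier G \<Longrightarrow> conjugate g \<one> = \<one>"
  by (simp add: conjugate_def)

lemma conjugate_mult:
  "g \<in> carrier G \<Longrightarrow> x \<in> carrier G \<Longrightarrow> y \<in> carrier G \<Longrightarrow> conjugate g (x \<otimes> y) = conjugate g x \<otimes> conjugate g y"
proof -
  assume c: "g \<in> carrier G" "x \<in> carrier G" "y \<in> carrier G"
  then have "inv g \<otimes> (g \<otimes> (y \<otimes> inv g)) = y \<otimes> inv g" by (simp flip: m_assoc)
  then show ?thesis using c by (simp add: conjugate_def m_assoc)
qed

lemma conjugate_cj:
  "g \<in> carrier G \<Longrightarrow> g' \<in> carrier G \<Longrightarrow> h \<in> carrier G \<Longrightarrow> conjugate g (conjugate g' h) = conjugate (g \<otimes> g') h"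
  by (simp add: conjugate_def m_assoc inv_mult_group)

lemma conjugate_inj: "g \<in> carrier G \<Longrightarrow> x \<in> carrier G \<Longrightarrow> y \<in> carrier G \<Longrightarrow> conjugate g x = conjugate g y \<longleftrightarrow> x = y"
  by (simp add: conjugate_def)

lemma act_closed [simp]: "g \<in> carrier G \<Longrightarrow> w \<in> T \<Longrightarrow> \<phi> g w \<in> T"
  using element_image by blast

lemma act_mult: "g \<in> carrier G \<Longrightarrow> h \<in> carrier G \<Longrightarrow> w \<in> T \<Longrightarrow> \<phi> (g \<otimes> h) w = \<phi> g (\<phi> h w)"
  by (rule composition_rule)

lemma act_one [simp]: "w \<in> T \<Longrightarrow> \<phi> \<one> w = w"
  using id_eq_one by (metis restrict_apply')

lemma act_inv_act [simp]: "g \<in> carrier G \<Longrightarrow> w \<in> T \<Longrightarrow> \<phi> (inv g) (\<phi> g w) = w"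
  by (simp flip: act_mult)

lemma act_act_inv [simp]: "g \<in> carrier G \<Longrightarrow> w \<in> T \<Longrightarrow> \<phi> g (\<phi> (inv g) w) = w"
  by (simp flip: act_mult)

lemma act_inj: "g \<in> carrier G \<Longrightarrow> u \<in> T \<Longrightarrow> w \<in> T \<Longrightarrow> \<phi> g u = \<phi> g w \<longleftrightarrow> u = w"
  by (metis act_inv_act)

lemma act_prefix_iff:
  "g \<in> carrier G \<Longrightarrow> u \<in> T \<Longrightarrow> w \<in> T \<Longrightarrow> prefix (\<phi> g u) (\<phi> g w) \<longleftrightarrow> prefix u w"
  using aut by (simp add: tree_aut_def)

lemma act_cj: "g \<in> carrier G \<Longrightarrow> h \<in> carrier G \<Longrightarrow> w \<in> T \<Longrightarrow> \<phi> (conjugate g h) (\<phi> g w) = \<phi> g (\<phi> h w)"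
  by (simp add: conjugate_def act_mult)

text \<open>Automorphisms are only known to respect the prefix order. The prefixes of
  \<open>\<phi> g w\<close> are the images of the prefixes of \<open>w\<close>, and counting them
  compares the lengths.\<close>

lemma act_length [simp]:
  assumes g: "g \<in> carrier G" and w: "w \<in> T"
  shows "length (\<phi> g w) = length w"
proof -
  have "{u. prefix u (\<phi> g w)} = \<phi> g ` {u. prefix u w}"
  proof (intro equalityI subsetI)
    fix u assume "u \<in> {u. prefix u (\<phi> g w)}"
    then have u: "u \<in> T" "prefix u (\<phi> g w)"
      using prefix_in_sh_tree[of u "\<phi> g w"] g w by auto
    have "prefix (\<phi> (inv g) u) w"
      using act_prefix_iff[of g "\<phi> (inv g) u" w] u g w by simp
    then show "u \<in> \<phi> g ` {u. prefix u w}"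
      using u g by (auto intro!: image_eqI[of _ _ "\<phi> (inv g) u"])
  next
    fix u assume "u \<in> \<phi> g ` {u. prefix u w}"
    then obtain u' where "u = \<phi> g u'" "prefix u' w" by blast
    then show "u \<in> {u. prefix u (\<phi> g w)}"
      using act_prefix_iff[of g u' w] prefix_in_sh_tree[of u' w] g w by simp
  qed
  moreover have "inj_on (\<phi> g) {u. prefix u w}"
    by (rule inj_on_subset[OF inj_prop[OF g]]) (use prefix_in_sh_tree w in blast)
  ultimately have "card {u. prefix u (\<phi> g w)} = card {u. prefix u w}"
    by (simp add: card_image)
  then show ?thesis
    using card_set_prefixes[of w] card_set_prefixes[of "\<phi> g w"] by (simp add: set_prefixes_eq)
qed

lemma level_in_tree: "v \<in> lev n \<Longrightarrow> v \<in> T"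
  by (simp add: tree_level_def)

lemma act_level [simp]: "g \<in> carrier G \<Longrightarrow> v \<in> lev n \<Longrightarrow> \<phi> g v \<in> lev n"
  by (simp add: tree_level_def)

text \<open>Faithfulness concerns the functions \<open>\<phi> g\<close>; these are extensional on
  the tree, so agreement on vertices is enough.\<close>

lemma act_eqI:
  assumes "g \<in> carrier G" "h \<in> carrier G" "\<And>w. w \<in> T \<Longrightarrow> \<phi> g w = \<phi> h w"
  shows "g = h"
proof -
  have "\<phi> g = \<phi> h"
    using bij_prop0[OF assms(1)] bij_prop0[OF assms(2)] assms(3)
    by (intro extensionalityI[of _ T]) (auto simp: Bij_def)
  then show ?thesis using faithful assms by (meson inj_onD)
qed

section \<open>Rigid stabilisers of vertices\<close>

lemma rist_carrier: "h \<in> R v \<Longrightarrow> h \<in> carrier G"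
  by (simp add: rist_def)

lemma rist_fix: "h \<in> R v \<Longrightarrow> w \<in> T \<Longrightarrow> \<not> prefix v w \<Longrightarrow> \<phi> h w = w"
  by (simp add: rist_def)

lemma rist_subgroup: "subgroup (R v) G"
proof (rule subgroupI)
  fix a assume a: "a \<in> R v"
  then show "inv a \<in> R v"
    by (auto simp: rist_def) (metis act_inv_act)
qed (auto simp: rist_def act_mult)

lemma rist_one: "\<one> \<in> R v"
  by (rule subgroup.one_closed[OF rist_subgroup])

text \<open>If \<open>h\<close> moved \<open>w\<close> out of the subtree at \<open>v\<close>, it
  would fix the image of \<open>w\<close>, and injectivity would give
  \<open>\<phi> h w = w\<close>.\<close>

lemma rist_prefix:
  assumes "h \<in> R v" "w \<in> T" "prefix v w"
  shows "prefix v (\<phi> h w)"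
proof (rule ccontr)
  assume "\<not> prefix v (\<phi> h w)"
  then have "\<phi> h (\<phi> h w) = \<phi> h w" using assms rist_fix rist_carrier by simp
  then have "\<phi> h w = w" using assms act_inj rist_carrier by simp
  then show False using assms \<open>\<not> prefix v (\<phi> h w)\<close> by simp
qed

lemma rist_eqI:
  assumes "g \<in> R v" "h \<in> R v" "\<And>w. w \<in> T \<Longrightarrow> prefix v w \<Longrightarrow> \<phi> g w = \<phi> h w"
  shows "g = h"
  using assms by (intro act_eqI) (metis rist_carrier rist_fix)+

lemma conjugate_rist:
  assumes "g \<in> carrier G" "v \<in> T" "h \<in> R v"
  shows "conjugate g h \<in> R (\<phi> g v)"
proof -
  have "\<phi> (conjugate g h) w = w" if w: "w \<in> T" "\<not> prefix (\<phi> g v) w" for w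
  proof -
    have "\<not> prefix v (\<phi> (inv g) w)"
      using act_prefix_iff[of g v "\<phi> (inv g) w"] w assms by simp
    then have "\<phi> h (\<phi> (inv g) w) = \<phi> (inv g) w"
      using assms w by (intro rist_fix) auto
    then show ?thesis
      using act_cj[of g h "\<phi> (inv g) w"] assms w rist_carrier by simp
  qed
  then show ?thesis using assms by (simp add: rist_def)
qed

section \<open>The rigid level stabiliser as an internal direct product\<close>

definition rist_product :: "nat \<Rightarrow> (nat list \<Rightarrow> 'a) monoid" where
  "rist_product n = product_group (lev n) (\<lambda>v. G\<lparr>carrier := R v\<rparr>)"

lemma group_rist_product: "group (rist_product n)"
  unfolding rist_product_def
  by (intro product_group subgroup_imp_group rist_subgroup)

lemma carrier_rist_product: "carrier (rist_product n) = (\<Pi>\<^sub>E v\<in>lev n. R v)"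
  by (simp add: rist_product_def)

lemma mult_rist_product: "f \<otimes>\<^bsub>rist_product n\<^esub> f' = (\<lambda>v\<in>lev n. f v \<otimes> f' v)"
  by (simp add: rist_product_def)

lemma rist_product_rist: "f \<in> carrier (rist_product n) \<Longrightarrow> v \<in> lev n \<Longrightarrow> f v \<in> R v"
  by (auto simp: carrier_rist_product)

lemma rist_product_carrier: "f \<in> carrier (rist_product n) \<Longrightarrow> v \<in> lev n \<Longrightarrow> f v \<in> carrier G"
  using rist_product_rist rist_carrier by blast

text \<open>A relation first, since it must be proved that the automorphism assembled from
  \<open>f\<close> comes from an element of the group. Faithfulness makes that element unique, so
  that \<open>glue\<close> can name it.\<close>

definition glues :: "nat \<Rightarrow> (nat list \<Rightarrow> 'a) \<Rightarrow> 'a \<Rightarrow> bool" where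
  "glues n f g \<longleftrightarrow> (\<forall>w\<in>T. length w < n \<longrightarrow> \<phi> g w = w) \<and>
    (\<forall>v\<in>lev n. \<forall>w\<in>T. prefix v w \<longrightarrow> \<phi> g w = \<phi> (f v) w)"

definition glue :: "nat \<Rightarrow> (nat list \<Rightarrow> 'a) \<Rightarrow> 'a" where
  "glue n f = (THE g. g \<in> carrier G \<and> glues n f g)"

lemma glues_unique:
  assumes "g \<in> carrier G" "h \<in> carrier G" "glues n f g" "glues n f h"
  shows "g = h"
proof (rule act_eqI[OF assms(1,2)])
  fix w assume w: "w \<in> T"
  then show "\<phi> g w = \<phi> h w"
    by (cases rule: tree_level_cases[of w k n]) (use w assms in \<open>auto simp: glues_def\<close>)
qed

lemma rist_level_carrier: "(\<Union>v\<in>lev n. R v) \<subseteq> carrier G"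
  using rist_carrier by blast

text \<open>Induction over a finite set outside which \<open>f\<close> is trivial: the element for
  \<open>f\<close> with the entry at \<open>u\<close> erased is multiplied by \<open>f u\<close>.
  The factors do not interfere, because \<open>f v\<close> preserves the subtree at \<open>v\<close>
  and \<open>f u\<close> fixes it pointwise when \<open>u\<close> and \<open>v\<close>
  differ.\<close>

lemma glues_exists:
  assumes f: "f \<in> carrier (rist_product n)"
  shows "\<exists>g\<in>rist_level G k \<phi> n. glues n f g"
proof -
  have "\<exists>g\<in>rist_level G k \<phi> n. glues n f g"
    if "finite A" "A \<subseteq> lev n" "f \<in> carrier (rist_product n)"
      "\<And>v. v \<in> lev n - A \<Longrightarrow> f v = \<one>" for A f
    using that
  proof (induction A arbitrary: f rule: finite_induct)
    case empty
    then have "glues n f \<one>" by (auto simp: glues_def)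
    then show ?case unfolding rist_level_def using generate.one by blast
  next
    case (insert u A)
    define f' where "f' = f(u := \<one>)"
    have u: "u \<in> lev n" using insert by auto
    have f'c: "f' \<in> carrier (rist_product n)"
      using insert.prems(2) u rist_one
      by (auto simp: f'_def carrier_rist_product PiE_iff extensional_def)
    have "f' v = \<one>" if "v \<in> lev n - A" for v
      using insert.prems(3)[of v] that by (auto simp: f'_def)
    then obtain g where g: "g \<in> rist_level G k \<phi> n" "glues n f' g"
      using insert.IH[OF _ f'c] insert.prems(1) by blast
    have gc: "g \<in> carrier G"
      using g generate_in_carrier[OF rist_level_carrier] by (auto simp: rist_level_def)
    have fu: "f u \<in> R u" "f u \<in> carrier G"
      using rist_product_rist rist_product_carrier insert.prems(2) u by auto
    have "f u \<otimes> g \<in> rist_level G k \<phi> n"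
      using g(1) fu(1) u unfolding rist_level_def by (blast intro: generate.eng[OF generate.incl])
    moreover have "glues n f (f u \<otimes> g)"
      unfolding glues_def
    proof (intro conjI ballI impI)
      fix w assume w: "w \<in> T" "length w < n"
      then have "\<not> prefix u w"
        using u prefix_length_le by (fastforce simp: tree_level_def)
      then show "\<phi> (f u \<otimes> g) w = w"
        using w g gc fu rist_fix[OF fu(1)] by (simp add: act_mult glues_def)
    next
      fix v w assume v: "v \<in> lev n" "w \<in> T" "prefix v w"
      have gw: "\<phi> g w = \<phi> (f' v) w" using g v by (simp add: glues_def)
      show "\<phi> (f u \<otimes> g) w = \<phi> (f v) w"
      proof (cases "v = u")
        case True
        then show ?thesis using gw v gc fu by (simp add: act_mult f'_def)
      next
        case False
        have fv: "f v \<in> R v" "f v \<in> carrier G"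
          using rist_product_rist rist_product_carrier insert.prems(2) v by auto
        have "prefix v (\<phi> (f v) w)" using rist_prefix fv v by blast
        then have "\<not> prefix u (\<phi> (f v) w)"
          using tree_level_prefix_unique[OF u v(1)] False by blast
        then show ?thesis
          using False gw v gc fu fv rist_fix[OF fu(1)] by (simp add: act_mult f'_def)
      qed
    qed
    ultimately show ?case by blast
  qed
  from this[OF finite_tree_level subset_refl f] show ?thesis by simp
qed

lemma glue:
  assumes "f \<in> carrier (rist_product n)"
  shows "glue n f \<in> rist_level G k \<phi> n" "glue n f \<in> carrier G" "glues n f (glue n f)"
proof -
  obtain g where g: "g \<in> rist_level G k \<phi> n" "glues n f g" using glues_exists[OF assms] by blast
  have gc: "g \<in> carrier G"
    using g generate_in_carrier[OF rist_level_carrier] by (auto simp: rist_level_def)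
  have "glue n f = g"
    unfolding glue_def using g gc glues_unique by (intro the_equality) auto
  then show "glue n f \<in> rist_level G k \<phi> n" "glue n f \<in> carrier G" "glues n f (glue n f)"
    using g gc by auto
qed

lemma act_glue:
  "f \<in> carrier (rist_product n) \<Longrightarrow> v \<in> lev n \<Longrightarrow> w \<in> T \<Longrightarrow> prefix v w \<Longrightarrow> \<phi> (glue n f) w = \<phi> (f v) w"
  using glue(3)[of f n] unfolding glues_def by blast

lemma glue_eqI:
  "f \<in> carrier (rist_product n) \<Longrightarrow> g \<in> carrier G \<Longrightarrow> glues n f g \<Longrightarrow> glue n f = g"
  using glues_unique[OF glue(2) _ glue(3)] by blast

lemma glue_hom: "group_hom (rist_product n) G (glue n)"
proof -
  interpret P: group "rist_product n" by (rule group_rist_product)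
  have "glue n \<in> hom (rist_product n) G"
  proof (rule homI)
    fix f f' assume f: "f \<in> carrier (rist_product n)" "f' \<in> carrier (rist_product n)"
    have "glues n (f \<otimes>\<^bsub>rist_product n\<^esub> f') (glue n f \<otimes> glue n f')"
      unfolding glues_def
    proof (intro conjI ballI impI)
      fix w assume w: "w \<in> T" "length w < n"
      then show "\<phi> (glue n f \<otimes> glue n f') w = w"
        using glue[OF f(1)] glue[OF f(2)] by (simp add: act_mult glues_def)
    next
      fix v w assume v: "v \<in> lev n" "w \<in> T" "prefix v w"
      have "prefix v (\<phi> (f' v) w)"
        using rist_prefix rist_product_rist f v by blast
      then show "\<phi> (glue n f \<otimes> glue n f') w = \<phi> ((f \<otimes>\<^bsub>rist_product n\<^esub> f') v) w"
        using v f glue[OF f(1)] glue[OF f(2)] rist_product_carrier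
        by (simp add: act_mult act_glue mult_rist_product)
    qed
    then show "glue n (f \<otimes>\<^bsub>rist_product n\<^esub> f') = glue n f \<otimes> glue n f'"
      using f glue by (intro glue_eqI) auto
  qed (rule glue(2))
  then show ?thesis by unfold_locales
qed

lemma glue_inj: "inj_on (glue n) (carrier (rist_product n))"
proof (rule inj_onI)
  fix f f' assume f: "f \<in> carrier (rist_product n)" "f' \<in> carrier (rist_product n)"
    and eq: "glue n f = glue n f'"
  show "f = f'"
  proof (rule extensionalityI[of _ "lev n"])
    fix v assume v: "v \<in> lev n"
    show "f v = f' v"
    proof (rule rist_eqI)
      fix w assume w: "w \<in> T" "prefix v w"
      show "\<phi> (f v) w = \<phi> (f' v) w"
        using act_glue[OF f(1) v w] act_glue[OF f(2) v w] eq by simp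
    qed (use rist_product_rist f v in blast)+
  qed (use f in \<open>auto simp: carrier_rist_product PiE_iff\<close>)
qed

text \<open>Each \<open>R v\<close> is the image of the families supported at \<open>v\<close>. With
  \<open>glue_hom\<close> and \<open>glue_inj\<close> this identifies the rigid level stabiliser
  with the direct product of the rigid vertex stabilisers.\<close>

lemma glue_image: "glue n ` carrier (rist_product n) = rist_level G k \<phi> n"
proof
  show "glue n ` carrier (rist_product n) \<subseteq> rist_level G k \<phi> n" using glue(1) by blast
  interpret glue: group_hom "rist_product n" G "glue n" by (rule glue_hom)
  have "R v \<subseteq> glue n ` carrier (rist_product n)" if v: "v \<in> lev n" for v
  proof
    fix h assume h: "h \<in> R v"
    define f where "f = (\<lambda>u\<in>lev n. if u = v then h else \<one>)"
    have f: "f \<in> carrier (rist_product n)"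
      using h rist_one by (auto simp: f_def carrier_rist_product)
    have "glues n f h"
      unfolding glues_def
    proof (intro conjI ballI impI)
      fix w assume w: "w \<in> T" "length w < n"
      then have "\<not> prefix v w"
        using v prefix_length_le by (fastforce simp: tree_level_def)
      then show "\<phi> h w = w" using h w rist_fix by blast
    next
      fix u w assume u: "u \<in> lev n" "w \<in> T" "prefix u w"
      show "\<phi> h w = \<phi> (f u) w"
        using u rist_fix[OF h u(2)] tree_level_prefix_unique[OF u(1) v u(3)] by (auto simp: f_def)
    qed
    then have "h = glue n f" using glue_eqI[OF f rist_carrier[OF h]] by simp
    then show "h \<in> glue n ` carrier (rist_product n)" using f by blast
  qed
  moreover have "subgroup (glue n ` carrier (rist_product n)) G"
    using glue.img_is_subgroup .
  ultimately show "rist_level G k \<phi> n \<subseteq> glue n ` carrier (rist_product n)"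
    unfolding rist_level_def by (intro generate_subgroup_incl) auto
qed

text \<open>Conjugation by \<open>\<alpha>\<close> permutes the direct factors, sending the one at
  \<open>v\<close> to the one at \<open>\<phi> \<alpha> v\<close>. Commuting with
  \<open>\<alpha>\<close> therefore means equivariance of the family, checked by comparing actions
  below each vertex of the level.\<close>

lemma glue_centraliser_iff:
  assumes a: "\<alpha> \<in> carrier G" and f: "f \<in> carrier (rist_product n)"
  shows "glue n f \<in> centraliser G \<alpha> \<longleftrightarrow> (\<forall>v\<in>lev n. f (\<phi> \<alpha> v) = conjugate \<alpha> (f v))"
proof -
  note g = glue[OF f]
  have key: "\<phi> (glue n f) (\<phi> \<alpha> w) = \<phi> (f (\<phi> \<alpha> v)) (\<phi> \<alpha> w) \<and>
      \<phi> \<alpha> (\<phi> (glue n f) w) = \<phi> (conjugate \<alpha> (f v)) (\<phi> \<alpha> w)"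
    if v: "v \<in> lev n" "w \<in> T" "prefix v w" for v w
  proof
    have "prefix (\<phi> \<alpha> v) (\<phi> \<alpha> w)" using act_prefix_iff[OF a level_in_tree[OF v(1)] v(2)] v(3) by simp
    then show "\<phi> (glue n f) (\<phi> \<alpha> w) = \<phi> (f (\<phi> \<alpha> v)) (\<phi> \<alpha> w)"
      using act_glue[OF f act_level[OF a v(1)] act_closed[OF a v(2)]] by simp
    show "\<phi> \<alpha> (\<phi> (glue n f) w) = \<phi> (conjugate \<alpha> (f v)) (\<phi> \<alpha> w)"
      using act_glue[OF f v] act_cj[OF a rist_product_carrier[OF f v(1)] v(2)] by simp
  qed
  show ?thesis
  proof
    assume "glue n f \<in> centraliser G \<alpha>"
    then have comm: "\<phi> (glue n f) (\<phi> \<alpha> w) = \<phi> \<alpha> (\<phi> (glue n f) w)" if "w \<in> T" for w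
      using that g(2) a act_mult[of "glue n f" \<alpha> w] act_mult[of \<alpha> "glue n f" w]
      by (simp add: centraliser_def)
    show "\<forall>v\<in>lev n. f (\<phi> \<alpha> v) = conjugate \<alpha> (f v)"
    proof
      fix v assume v: "v \<in> lev n"
      show "f (\<phi> \<alpha> v) = conjugate \<alpha> (f v)"
      proof (rule rist_eqI[of _ "\<phi> \<alpha> v"])
        show "f (\<phi> \<alpha> v) \<in> R (\<phi> \<alpha> v)" using rist_product_rist[OF f] v a by simp
        show "conjugate \<alpha> (f v) \<in> R (\<phi> \<alpha> v)"
          using conjugate_rist[OF a level_in_tree[OF v] rist_product_rist[OF f v]] .
        fix w assume w: "w \<in> T" "prefix (\<phi> \<alpha> v) w"
        define w' where "w' = \<phi> (inv \<alpha>) w"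
        have w': "w' \<in> T" "w = \<phi> \<alpha> w'" using w a by (auto simp: w'_def)
        have "prefix v w'" using w w' a act_prefix_iff[of \<alpha> v w'] level_in_tree[OF v] by simp
        then show "\<phi> (f (\<phi> \<alpha> v)) w = \<phi> (conjugate \<alpha> (f v)) w"
          using key[OF v w'(1)] comm[OF w'(1)] w'(2) by metis
      qed
    qed
  next
    assume eq: "\<forall>v\<in>lev n. f (\<phi> \<alpha> v) = conjugate \<alpha> (f v)"
    have "glue n f \<otimes> \<alpha> = \<alpha> \<otimes> glue n f"
    proof (rule act_eqI)
      fix w assume w: "w \<in> T"
      show "\<phi> (glue n f \<otimes> \<alpha>) w = \<phi> (\<alpha> \<otimes> glue n f) w"
      proof (cases rule: tree_level_cases[OF w, of n])
        case 1
        then show ?thesis using g a w by (simp add: act_mult glues_def)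
      next
        case (2 v)
        then show ?thesis using key[OF 2(1) w 2(2)] eq g a w by (simp add: act_mult)
      qed
    qed (use g a in auto)
    then show "glue n f \<in> centraliser G \<alpha>" using g by (simp add: centraliser_def)
  qed
qed

text \<open>The coordinate projection makes \<open>R v\<close> a quotient of the rigid level
  stabiliser.\<close>

lemma fin_gen_rist:
  assumes "fin_gen_subgroup G (rist_level G k \<phi> n)" "v \<in> lev n"
  shows "fin_gen_group (G\<lparr>carrier := R v\<rparr>)"
proof -
  interpret P: group "rist_product n" by (rule group_rist_product)
  interpret Rv: group "G\<lparr>carrier := R v\<rparr>" by (intro subgroup_imp_group rist_subgroup)
  have fg: "fin_gen_subgroup (rist_product n) (carrier (rist_product n))"
    using fin_gen_subgroup_inj_image_iff[OF glue_hom glue_inj subset_refl, of n] glue_image assms(1)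
    by simp
  have hom: "group_hom (rist_product n) (G\<lparr>carrier := R v\<rparr>) (\<lambda>f. f v)"
    by unfold_locales (use assms(2) in \<open>auto intro!: homI simp: mult_rist_product intro: rist_product_rist\<close>)
  have "(\<lambda>f. f v) ` carrier (rist_product n) = R v"
  proof (intro equalityI subsetI)
    fix h assume "h \<in> R v"
    then show "h \<in> (\<lambda>f. f v) ` carrier (rist_product n)"
      using assms(2) rist_one
      by (intro image_eqI[of _ _ "\<lambda>u\<in>lev n. if u = v then h else \<one>"])
        (auto simp: carrier_rist_product)
  qed (use assms(2) rist_product_rist in auto)
  then show ?thesis
    using fin_gen_subgroup_hom_image[OF hom subset_refl fg] by (simp add: fin_gen_group_def)
qed

section \<open>Orbits of one element on a level and their norm maps\<close>

lemma act_pow_add: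
  "\<alpha> \<in> carrier G \<Longrightarrow> w \<in> T \<Longrightarrow> \<phi> (\<alpha> [^] (i + j :: nat)) w = \<phi> (\<alpha> [^] i) (\<phi> (\<alpha> [^] j) w)"
  using act_mult[of "\<alpha> [^] i" "\<alpha> [^] j" w] by (simp add: nat_pow_mult)

lemma conjugate_pow_add:
  "\<alpha> \<in> carrier G \<Longrightarrow> h \<in> carrier G \<Longrightarrow> conjugate (\<alpha> [^] (i + j :: nat)) h = conjugate (\<alpha> [^] i) (conjugate (\<alpha> [^] j) h)"
  using conjugate_cj[of "\<alpha> [^] i" "\<alpha> [^] j" h] by (simp add: nat_pow_mult)

text \<open>For a vertex this is the length of its orbit under \<alpha>.\<close>

definition return_time :: "'a \<Rightarrow> nat list \<Rightarrow> nat" where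
  "return_time \<alpha> v = (LEAST m. m > 0 \<and> \<phi> (\<alpha> [^] m) v = v)"

text \<open>The level is finite, so two powers of \<alpha> agree at \<open>v\<close>; cancelling the
  smaller one gives a positive power fixing \<open>v\<close>.\<close>

lemma return_time:
  assumes a: "\<alpha> \<in> carrier G" and v: "v \<in> lev n"
  shows "return_time \<alpha> v > 0" "\<phi> (\<alpha> [^] return_time \<alpha> v) v = v"
proof -
  have vT: "v \<in> T" using v by (rule level_in_tree)
  have "range (\<lambda>i::nat. \<phi> (\<alpha> [^] i) v) \<subseteq> lev n" using a v by auto
  then have "finite (range (\<lambda>i::nat. \<phi> (\<alpha> [^] i) v))"
    using finite_subset finite_tree_level by blast
  then have "\<not> inj (\<lambda>i::nat. \<phi> (\<alpha> [^] i) v)"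
    using finite_imageD infinite_UNIV_nat by blast
  then obtain i j where "i \<noteq> j" "\<phi> (\<alpha> [^] (i::nat)) v = \<phi> (\<alpha> [^] (j::nat)) v"
    unfolding inj_on_def by blast
  then obtain i j where ij: "i < j" "\<phi> (\<alpha> [^] (i::nat)) v = \<phi> (\<alpha> [^] (j::nat)) v"
    by (metis nat_neq_iff)
  have "\<phi> (\<alpha> [^] i) (\<phi> (\<alpha> [^] (j - i)) v) = \<phi> (\<alpha> [^] i) v"
    using act_pow_add[OF a vT, of i "j - i"] ij by simp
  then have "\<phi> (\<alpha> [^] (j - i)) v = v"
    using act_inj[of "\<alpha> [^] i" "\<phi> (\<alpha> [^] (j - i)) v" v] a vT by simp
  then have "\<exists>m::nat. m > 0 \<and> \<phi> (\<alpha> [^] m) v = v" using ij(1) by (intro exI[of _ "j - i"]) simp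
  from LeastI_ex[OF this] show "return_time \<alpha> v > 0" "\<phi> (\<alpha> [^] return_time \<alpha> v) v = v"
    unfolding return_time_def by auto
qed

lemma return_time_dvd:
  assumes a: "\<alpha> \<in> carrier G" and v: "v \<in> lev n" and d: "\<phi> (\<alpha> [^] d) v = v"
  shows "return_time \<alpha> v dvd d"
proof (rule ccontr)
  let ?m = "return_time \<alpha> v"
  assume "\<not> ?m dvd d"
  then have r: "d mod ?m > 0" "d mod ?m < ?m" using return_time[OF a v] by (auto simp: dvd_eq_mod_eq_0)
  have vT: "v \<in> T" using v by (rule level_in_tree)
  have "\<phi> (\<alpha> [^] (q * ?m)) v = v" for q
  proof (induction q)
    case (Suc q)
    then show ?case using act_pow_add[OF a vT, of ?m "q * ?m"] return_time[OF a v] by simp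
  qed (use vT in simp)
  then have "\<phi> (\<alpha> [^] (d mod ?m)) v = v"
    using act_pow_add[OF a vT, of "d mod ?m" "(d div ?m) * ?m"] d by simp
  then show False
    using r not_less_Least[of "d mod ?m" "\<lambda>m. m > 0 \<and> \<phi> (\<alpha> [^] m) v = v"]
    unfolding return_time_def by simp
qed

text \<open>The contribution of the orbit of \<open>v\<close> to the centraliser of \<alpha>,
  written as a set of fixed points of a conjugation to match the form of \<open>\<theta>\<close> in
  \<open>realisable_power\<close>.\<close>

definition return_centraliser :: "'a \<Rightarrow> nat list \<Rightarrow> 'a set" where
  "return_centraliser \<alpha> v = {h \<in> R v. conjugate (\<alpha> [^] return_time \<alpha> v) h = h}"

lemma return_centraliserD:
  "h \<in> return_centraliser \<alpha> v \<Longrightarrow> h \<in> R v" "h \<in> return_centraliser \<alpha> v \<Longrightarrow> h \<in> carrier G"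
  by (auto simp: return_centraliser_def intro: rist_carrier)

lemma return_centraliser_subgroup:
  assumes "\<alpha> \<in> carrier G"
  shows "subgroup (return_centraliser \<alpha> v) G"
proof (rule subgroupI)
  have p: "\<alpha> [^] return_time \<alpha> v \<in> carrier G" using assms by simp
  show "return_centraliser \<alpha> v \<subseteq> carrier G" using return_centraliserD by blast
  show "return_centraliser \<alpha> v \<noteq> {}"
    using rist_one[of v] p by (auto simp: return_centraliser_def)
  show "x \<otimes> y \<in> return_centraliser \<alpha> v"
    if "x \<in> return_centraliser \<alpha> v" "y \<in> return_centraliser \<alpha> v" for x y
    using that p conjugate_mult[OF p, of x y] rist_carrier[of x v] rist_carrier[of y v] subgroup.m_closed[OF rist_subgroup, of x v y]
    by (simp add: return_centraliser_def)
  show "inv x \<in> return_centraliser \<alpha> v" if x: "x \<in> return_centraliser \<alpha> v" for x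
  proof -
    let ?p = "\<alpha> [^] return_time \<alpha> v"
    have xc: "x \<in> carrier G" "conjugate ?p x = x" using x rist_carrier[of x v] by (simp_all add: return_centraliser_def)
    have "conjugate ?p (inv x) \<otimes> x = \<one>" using conjugate_mult[OF p, of "inv x" x] xc p by simp
    then have "conjugate ?p (inv x) = inv x" using xc p inv_equality[of "conjugate ?p (inv x)" x] by simp
    then show ?thesis
      using x subgroup.m_inv_closed[OF rist_subgroup, of x v] by (simp add: return_centraliser_def)
  qed
qed

text \<open>The exponents differ by a multiple of the return time, and conjugation by the
  corresponding power of \<alpha> fixes \<open>h\<close>. This makes the choice of exponent in the
  norm map immaterial.\<close>

lemma conjugate_pow_well_defined:
  assumes a: "\<alpha> \<in> carrier G" and v: "v \<in> lev n" and h: "h \<in> return_centraliser \<alpha> v"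
    and eq: "\<phi> (\<alpha> [^] (i::nat)) v = \<phi> (\<alpha> [^] (j::nat)) v"
  shows "conjugate (\<alpha> [^] i) h = conjugate (\<alpha> [^] j) h"
  using eq
proof (induction i j rule: linorder_wlog)
  case (le i j)
  let ?m = "return_time \<alpha> v"
  have vT: "v \<in> T" using v by (rule level_in_tree)
  have hc: "h \<in> carrier G" "conjugate (\<alpha> [^] ?m) h = h"
    using h return_centraliserD(2) by (auto simp: return_centraliser_def)
  have fixq: "conjugate (\<alpha> [^] (q * ?m)) h = h" for q
  proof (induction q)
    case 0
    then show ?case using hc by (simp add: conjugate_def)
  next
    case (Suc q)
    then show ?case using conjugate_pow_add[OF a hc(1), of ?m "q * ?m"] hc by simp
  qed
  have "\<phi> (\<alpha> [^] i) (\<phi> (\<alpha> [^] (j - i)) v) = \<phi> (\<alpha> [^] i) v"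
    using act_pow_add[OF a vT, of i "j - i"] le by simp
  then have "\<phi> (\<alpha> [^] (j - i)) v = v"
    using act_inj[of "\<alpha> [^] i" "\<phi> (\<alpha> [^] (j - i)) v" v] a vT by simp
  then obtain q where "j - i = q * ?m" using return_time_dvd[OF a v] by (metis dvdE mult.commute)
  then have "conjugate (\<alpha> [^] (j - i)) h = h" using fixq by simp
  then show ?case using conjugate_pow_add[OF a hc(1), of i "j - i"] le by simp
qed simp

text \<open>The norm map of an orbit: the product of the conjugates \<open>\<alpha>\<^sup>i h \<alpha>\<^sup>-\<^sup>i\<close>, each placed at its vertex.\<close>

definition norm_section :: "nat \<Rightarrow> 'a \<Rightarrow> nat list \<Rightarrow> 'a \<Rightarrow> nat list \<Rightarrow> 'a" where
  "norm_section n \<alpha> v h = (\<lambda>u\<in>lev n. if \<exists>i::nat. \<phi> (\<alpha> [^] i) v = u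
     then conjugate (\<alpha> [^] (SOME i::nat. \<phi> (\<alpha> [^] i) v = u)) h else \<one>)"

lemma norm_section_orbit:
  assumes "\<alpha> \<in> carrier G" "v \<in> lev n" "h \<in> return_centraliser \<alpha> v"
  shows "norm_section n \<alpha> v h (\<phi> (\<alpha> [^] (i::nat)) v) = conjugate (\<alpha> [^] i) h"
proof -
  let ?j = "SOME j::nat. \<phi> (\<alpha> [^] j) v = \<phi> (\<alpha> [^] i) v"
  have "\<phi> (\<alpha> [^] ?j) v = \<phi> (\<alpha> [^] i) v" by (rule someI[of _ i]) simp
  then have "conjugate (\<alpha> [^] ?j) h = conjugate (\<alpha> [^] i) h" by (rule conjugate_pow_well_defined[OF assms])
  moreover have "\<phi> (\<alpha> [^] i) v \<in> lev n" using assms by simp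
  ultimately show ?thesis unfolding norm_section_def by auto
qed

lemma norm_section_off_orbit:
  "u \<in> lev n \<Longrightarrow> \<nexists>i::nat. \<phi> (\<alpha> [^] i) v = u \<Longrightarrow> norm_section n \<alpha> v h u = \<one>"
  by (simp add: norm_section_def)

lemma norm_section_closed:
  assumes "\<alpha> \<in> carrier G" "v \<in> lev n" "h \<in> return_centraliser \<alpha> v"
  shows "norm_section n \<alpha> v h \<in> carrier (rist_product n)"
proof -
  have "norm_section n \<alpha> v h u \<in> R u" if u: "u \<in> lev n" for u
  proof (cases "\<exists>i::nat. \<phi> (\<alpha> [^] i) v = u")
    case True
    then obtain i :: nat where i: "u = \<phi> (\<alpha> [^] i) v" by blast
    show ?thesis
      unfolding i norm_section_orbit[OF assms]
      using assms level_in_tree return_centraliserD(1) by (intro conjugate_rist) auto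
  next
    case False
    then show ?thesis using norm_section_off_orbit[OF u] rist_one by simp
  qed
  then show ?thesis by (auto simp: carrier_rist_product norm_section_def)
qed

text \<open>The exponent chosen at \<open>u\<close> depends on \<open>u\<close> but not on
  \<open>h\<close>, so each coordinate is either a conjugation or the trivial map.\<close>

lemma norm_section_hom:
  assumes a: "\<alpha> \<in> carrier G" and v: "v \<in> lev n"
  shows "group_hom (G\<lparr>carrier := return_centraliser \<alpha> v\<rparr>) (rist_product n) (norm_section n \<alpha> v)"
proof -
  interpret C: group "G\<lparr>carrier := return_centraliser \<alpha> v\<rparr>"
    by (rule subgroup_imp_group[OF return_centraliser_subgroup[OF a]])
  interpret P: group "rist_product n" by (rule group_rist_product)
  show ?thesis
  proof (unfold_locales, rule homI)
    fix x assume x: "x \<in> carrier (G\<lparr>carrier := return_centraliser \<alpha> v\<rparr>)"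
    show "norm_section n \<alpha> v x \<in> carrier (rist_product n)"
      using norm_section_closed[OF a v] x by simp
    fix y assume y: "y \<in> carrier (G\<lparr>carrier := return_centraliser \<alpha> v\<rparr>)"
    have "x \<in> carrier G" "y \<in> carrier G" using x y return_centraliserD(2) by auto
    then show "norm_section n \<alpha> v (x \<otimes>\<^bsub>G\<lparr>carrier := return_centraliser \<alpha> v\<rparr>\<^esub> y) =
        norm_section n \<alpha> v x \<otimes>\<^bsub>rist_product n\<^esub> norm_section n \<alpha> v y"
      using conjugate_mult a by (auto simp: norm_section_def mult_rist_product)
  qed
qed

lemma norm_section_equivariant:
  assumes a: "\<alpha> \<in> carrier G" and v: "v \<in> lev n" and h: "h \<in> return_centraliser \<alpha> v"
    and u: "u \<in> lev n"
  shows "norm_section n \<alpha> v h (\<phi> \<alpha> u) = conjugate \<alpha> (norm_section n \<alpha> v h u)"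
proof (cases "\<exists>i::nat. \<phi> (\<alpha> [^] i) v = u")
  case True
  then obtain i :: nat where i: "u = \<phi> (\<alpha> [^] i) v" by blast
  have "\<phi> \<alpha> u = \<phi> (\<alpha> [^] (1 + i)) v"
    unfolding i act_pow_add[OF a level_in_tree[OF v]] using a by simp
  then have "norm_section n \<alpha> v h (\<phi> \<alpha> u) = conjugate (\<alpha> [^] (1 + i)) h"
    by (simp only: norm_section_orbit[OF a v h])
  also have "\<dots> = conjugate \<alpha> (conjugate (\<alpha> [^] i) h)"
    using conjugate_pow_add[OF a return_centraliserD(2)[OF h], of 1 i] a by simp
  finally show ?thesis by (simp add: i norm_section_orbit[OF a v h])
next
  case False
  have "\<nexists>i::nat. \<phi> (\<alpha> [^] i) v = \<phi> \<alpha> u"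
  proof
    assume "\<exists>i::nat. \<phi> (\<alpha> [^] i) v = \<phi> \<alpha> u"
    then obtain i :: nat where i: "\<phi> (\<alpha> [^] i) v = \<phi> \<alpha> u" by blast
    \<comment> \<open>An exponent one step before \<open>i\<close> is wanted. Adding the return time
      first keeps the subtraction on naturals meaningful for \<open>i = 0\<close>.\<close>
    define j where "j = i + return_time \<alpha> v - 1"
    have j: "1 + j = i + return_time \<alpha> v" using return_time[OF a v] by (simp add: j_def)
    have "\<phi> (\<alpha> [^] (1 + j)) v = \<phi> \<alpha> u"
      unfolding j act_pow_add[OF a level_in_tree[OF v]] return_time(2)[OF a v] i ..
    then have "\<phi> \<alpha> (\<phi> (\<alpha> [^] j) v) = \<phi> \<alpha> u"
      unfolding act_pow_add[OF a level_in_tree[OF v]] using a by simp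
    then have "\<phi> (\<alpha> [^] j) v = u"
      using act_inj[OF a, of "\<phi> (\<alpha> [^] j) v" u] a level_in_tree[OF v] level_in_tree[OF u] by simp
    then show False using False by blast
  qed
  then show ?thesis
    using norm_section_off_orbit[OF u False] norm_section_off_orbit[OF act_level[OF a u]] a by simp
qed

text \<open>An equivariant family is determined along an orbit by one entry. At the return time this
  forces that entry into \<open>return_centraliser\<close>.\<close>

lemma equivariant_pow:
  assumes a: "\<alpha> \<in> carrier G" and f: "f \<in> carrier (rist_product n)"
    and eq: "\<And>v. v \<in> lev n \<Longrightarrow> f (\<phi> \<alpha> v) = conjugate \<alpha> (f v)" and v: "v \<in> lev n"
  shows "f (\<phi> (\<alpha> [^] (i::nat)) v) = conjugate (\<alpha> [^] i) (f v)"
proof (induction i)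
  case 0
  then show ?case using v level_in_tree[OF v] rist_product_carrier[OF f v] by (simp add: conjugate_def)
next
  case (Suc i)
  have "f (\<phi> (\<alpha> [^] (1 + i)) v) = f (\<phi> \<alpha> (\<phi> (\<alpha> [^] i) v))"
    unfolding act_pow_add[OF a level_in_tree[OF v]] using a by simp
  also have "\<dots> = conjugate \<alpha> (conjugate (\<alpha> [^] i) (f v))"
    using eq[of "\<phi> (\<alpha> [^] i) v"] Suc a v by simp
  also have "\<dots> = conjugate (\<alpha> [^] (1 + i)) (f v)"
    using conjugate_pow_add[OF a rist_product_carrier[OF f v], of 1 i] a by simp
  finally show ?case by simp
qed

section \<open>The centraliser inside the rigid level stabiliser\<close>

lemma centraliser_subgroup: "\<alpha> \<in> carrier G \<Longrightarrow> subgroup (centraliser G \<alpha>) G"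
proof (rule subgroupI)
  assume a: "\<alpha> \<in> carrier G"
  fix x assume x: "x \<in> centraliser G \<alpha>"
  show "inv x \<in> centraliser G \<alpha>"
    using x a by (auto simp: centraliser_def) (metis inv_closed inv_solve_left inv_solve_right m_assoc m_closed)
  fix y assume y: "y \<in> centraliser G \<alpha>"
  show "x \<otimes> y \<in> centraliser G \<alpha>"
    using x y a by (auto simp: centraliser_def) (metis m_assoc)
qed (auto simp: centraliser_def)

text \<open>The intersection is generated by the finitely many subgroups \<open>N v\<close>, each an
  image of a finitely generated \<open>return_centraliser\<close> under the norm map. Letting
  \<open>v\<close> run over the whole level avoids choosing orbit representatives.\<close>

lemma fin_gen_centraliser_Int_rist_level:
  assumes a: "\<alpha> \<in> carrier G"
    and fg: "\<And>v. v \<in> lev n \<Longrightarrow> fin_gen_subgroup G (return_centraliser \<alpha> v)"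
  shows "fin_gen_subgroup G (centraliser G \<alpha> \<inter> rist_level G k \<phi> n)"
proof -
  interpret P: group "rist_product n" by (rule group_rist_product)
  interpret glue: group_hom "rist_product n" G "glue n" by (rule glue_hom)
  define N where "N v = (\<lambda>h. glue n (norm_section n \<alpha> v h)) ` return_centraliser \<alpha> v" for v
  let ?K = "centraliser G \<alpha> \<inter> rist_level G k \<phi> n"
  have K: "subgroup ?K G"
    unfolding rist_level_def
    by (intro subgroups_Inter_pair centraliser_subgroup a generate_is_subgroup rist_level_carrier)
  have section_centraliser: "glue n (norm_section n \<alpha> v h) \<in> centraliser G \<alpha>"
    if "v \<in> lev n" "h \<in> return_centraliser \<alpha> v" for v h
    using glue_centraliser_iff[OF a norm_section_closed[OF a that]]
      norm_section_equivariant[OF a that] by blast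
  have NK: "N v \<subseteq> ?K" if v: "v \<in> lev n" for v
    using section_centraliser[OF v] glue(1)[OF norm_section_closed[OF a v]] by (auto simp: N_def)
  have Nc: "N v \<subseteq> carrier G" if "v \<in> lev n" for v
    using NK[OF that] subgroup.subset[OF K] by blast
  have "fin_gen_subgroup G (N v)" if v: "v \<in> lev n" for v
  proof -
    let ?C = "return_centraliser \<alpha> v"
    have "fin_gen_subgroup (G\<lparr>carrier := ?C\<rparr>) ?C"
      using fg[OF v] fin_gen_subgroup_consistent[OF return_centraliser_subgroup[OF a] subset_refl] by simp
    then have "fin_gen_subgroup (rist_product n) (norm_section n \<alpha> v ` ?C)"
      using fin_gen_subgroup_hom_image[OF norm_section_hom[OF a v], of ?C] by simp
    then have "fin_gen_subgroup G (glue n ` norm_section n \<alpha> v ` ?C)"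
      using norm_section_closed[OF a v]
      by (intro fin_gen_subgroup_hom_image[OF glue_hom]) auto
    then show ?thesis by (simp add: N_def image_image)
  qed
  then have "fin_gen_subgroup G (generate G (\<Union>v\<in>lev n. N v))"
    using Nc by (intro fin_gen_subgroup_UN finite_tree_level)
  moreover have "generate G (\<Union>v\<in>lev n. N v) \<subseteq> ?K"
    using NK by (intro generate_subgroup_incl K) blast
  moreover have "glue n f \<in> generate G (\<Union>v\<in>lev n. N v)"
    if "f \<in> carrier (rist_product n)" "glue n f \<in> centraliser G \<alpha>" for f
    using that
  \<comment> \<open>Induction on the number of nontrivial entries: dividing by the norm of the entry
    at \<open>v\<close> clears the orbit of \<open>v\<close> and leaves the other entries
    unchanged.\<close>
  proof (induction "card {v \<in> lev n. f v \<noteq> \<one>}" arbitrary: f rule: less_induct)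
    case less
    note f = less.prems(1)
    have eq: "f (\<phi> \<alpha> v) = conjugate \<alpha> (f v)" if "v \<in> lev n" for v
      using glue_centraliser_iff[OF a f] less.prems(2) that by blast
    show ?case
    proof (cases "\<forall>v\<in>lev n. f v = \<one>")
      case True
      then have "f = \<one>\<^bsub>rist_product n\<^esub>"
        using f by (auto simp: rist_product_def PiE_iff extensional_def)
      then show ?thesis by (simp add: generate.one)
    next
      case False
      then obtain v where v: "v \<in> lev n" "f v \<noteq> \<one>" by blast
      have fv: "f v \<in> return_centraliser \<alpha> v"
        using equivariant_pow[OF a f eq v(1), of "return_time \<alpha> v"] return_time(2)[OF a v(1)]
          rist_product_rist[OF f v(1)]
        by (simp add: return_centraliser_def)
      let ?s = "norm_section n \<alpha> v (f v)"
      have s: "?s \<in> carrier (rist_product n)" by (rule norm_section_closed[OF a v(1) fv])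
      define f' where "f' = inv\<^bsub>rist_product n\<^esub> ?s \<otimes>\<^bsub>rist_product n\<^esub> f"
      have f': "f' \<in> carrier (rist_product n)" using s f by (simp add: f'_def)
      have ff': "f = ?s \<otimes>\<^bsub>rist_product n\<^esub> f'"
        using s f by (simp add: f'_def flip: P.m_assoc)
      have split: "f u = ?s u \<otimes> f' u" if "u \<in> lev n" for u
        using that by (subst ff') (simp add: mult_rist_product)
      have on: "f' u = \<one>" if u: "u \<in> lev n" "u = \<phi> (\<alpha> [^] (i::nat)) v" for u i
      proof -
        have "f u = ?s u"
          using equivariant_pow[OF a f eq v(1), of i] norm_section_orbit[OF a v(1) fv, of i] u(2)
          by simp
        then have "?s u = ?s u \<otimes> f' u" using split[OF u(1)] by simp
        then show ?thesis
          using rist_product_carrier[OF s u(1)] rist_product_carrier[OF f' u(1)] by simp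
      qed
      have off: "f' u = f u" if u: "u \<in> lev n" "\<nexists>i::nat. \<phi> (\<alpha> [^] i) v = u" for u
        using split[OF u(1)] norm_section_off_orbit[OF u] rist_product_carrier[OF f' u(1)] by simp
      have supp: "{u \<in> lev n. f' u \<noteq> \<one>} \<subseteq> {u \<in> lev n. f u \<noteq> \<one>} - {v}"
      proof
        fix u assume u: "u \<in> {u \<in> lev n. f' u \<noteq> \<one>}"
        then have no: "\<nexists>i::nat. \<phi> (\<alpha> [^] i) v = u" using on by blast
        then have "u \<noteq> v" using level_in_tree[OF v(1)] by (metis act_one nat_pow_0)
        then show "u \<in> {u \<in> lev n. f u \<noteq> \<one>} - {v}" using off[OF _ no] u by auto
      qed
      have "card {u \<in> lev n. f' u \<noteq> \<one>} < card {u \<in> lev n. f u \<noteq> \<one>}"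
        using supp v finite_tree_level[of k n] by (intro psubset_card_mono) auto
      moreover have gs: "glue n ?s \<in> centraliser G \<alpha>" by (rule section_centraliser[OF v(1) fv])
      have "glue n f' = inv (glue n ?s) \<otimes> glue n f"
        using s f by (simp add: f'_def)
      then have "glue n f' \<in> centraliser G \<alpha>"
        using gs less.prems(2) centraliser_subgroup[OF a]
        by (simp add: subgroup.m_closed subgroup.m_inv_closed)
      ultimately have "glue n f' \<in> generate G (\<Union>v\<in>lev n. N v)"
        using less.hyps f' by blast
      moreover have "glue n ?s \<in> (\<Union>v\<in>lev n. N v)" using v(1) fv by (auto simp: N_def)
      moreover have "glue n f = glue n ?s \<otimes> glue n f'" using s f' by (subst ff') simp
      ultimately show ?thesis by (simp add: generate.eng generate.incl)
    qed
  qed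
  then have "?K \<subseteq> generate G (\<Union>v\<in>lev n. N v)" by (auto simp flip: glue_image)
  ultimately show ?thesis by (metis subset_antisym)
qed

text \<open>Conjugation by an element moving \<open>v\<close> to \<open>u\<close> carries
  \<open>R v\<close> into \<open>R u\<close>. The coordinate at \<open>i\<close> is placed at the
  vertex \<open>e i\<close> in this way, the other vertices receive \<open>\<one>\<close>, and
  \<open>glue\<close> turns the family into a group element. Injectivity holds because distinct
  coordinates occupy distinct vertices.\<close>

lemma rist_power_embedding:
  assumes v: "v \<in> lev n" and e: "inj_on e I" "e ` I \<subseteq> lev n"
    and trans: "\<And>u. u \<in> lev n \<Longrightarrow> \<exists>g\<in>carrier G. \<phi> g v = u"
  obtains h where "group_hom (product_group I (\<lambda>_. G\<lparr>carrier := R v\<rparr>)) G h"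
    "inj_on h (carrier (product_group I (\<lambda>_. G\<lparr>carrier := R v\<rparr>)))"
proof -
  let ?Q = "product_group I (\<lambda>_. G\<lparr>carrier := R v\<rparr>)"
  obtain \<gamma> where \<gamma>: "\<And>u. u \<in> lev n \<Longrightarrow> \<gamma> u \<in> carrier G \<and> \<phi> (\<gamma> u) v = u"
    using trans by metis
  interpret P: group "rist_product n" by (rule group_rist_product)
  interpret Q: group ?Q by (intro product_group subgroup_imp_group rist_subgroup)
  interpret glue: group_hom "rist_product n" G "glue n" by (rule glue_hom)
  define E where "E f = (\<lambda>u\<in>lev n. if u \<in> e ` I then conjugate (\<gamma> u) (f (inv_into I e u)) else \<one>)" for f
  have Qc: "f i \<in> R v" "f i \<in> carrier G" if "f \<in> carrier ?Q" "i \<in> I" for f i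
    using that by (auto simp: PiE_iff rist_carrier)
  have E_closed: "E f \<in> carrier (rist_product n)" if f: "f \<in> carrier ?Q" for f
  proof -
    have "conjugate (\<gamma> u) (f (inv_into I e u)) \<in> R u" if u: "u \<in> lev n" "u \<in> e ` I" for u
      using conjugate_rist[of "\<gamma> u" v "f (inv_into I e u)"] \<gamma>[OF u(1)] level_in_tree[OF v]
        Qc(1)[OF f inv_into_into[OF u(2)]] by simp
    then show ?thesis by (auto simp: E_def carrier_rist_product rist_one)
  qed
  have E_mult: "E (f \<otimes>\<^bsub>?Q\<^esub> f') = E f \<otimes>\<^bsub>rist_product n\<^esub> E f'"
    if f: "f \<in> carrier ?Q" "f' \<in> carrier ?Q" for f f'
  proof
    fix u
    show "E (f \<otimes>\<^bsub>?Q\<^esub> f') u = (E f \<otimes>\<^bsub>rist_product n\<^esub> E f') u"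
    proof (cases "u \<in> lev n \<and> u \<in> e ` I")
      case True
      then have i: "inv_into I e u \<in> I" using inv_into_into by metis
      then have "conjugate (\<gamma> u) (f (inv_into I e u) \<otimes> f' (inv_into I e u)) =
          conjugate (\<gamma> u) (f (inv_into I e u)) \<otimes> conjugate (\<gamma> u) (f' (inv_into I e u))"
        using Qc(2)[OF f(1) i] Qc(2)[OF f(2) i] \<gamma> True by (intro conjugate_mult) auto
      then show ?thesis using True i by (simp add: E_def mult_rist_product)
    qed (auto simp: E_def mult_rist_product)
  qed
  have hom: "group_hom ?Q G (\<lambda>f. glue n (E f))"
    by unfold_locales (auto intro!: homI simp: E_closed E_mult simp del: carrier_product_group mult_product_group)
  have inj: "inj_on (\<lambda>f. glue n (E f)) (carrier ?Q)"
  proof (rule inj_onI)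
    fix f f' assume f: "f \<in> carrier ?Q" "f' \<in> carrier ?Q" and "glue n (E f) = glue n (E f')"
    then have eq: "E f = E f'" using glue_inj E_closed by (meson inj_onD)
    show "f = f'"
    proof (rule extensionalityI[of _ I])
      fix i assume i: "i \<in> I"
      then have ei: "e i \<in> lev n" using e(2) by blast
      have "conjugate (\<gamma> (e i)) (f i) = conjugate (\<gamma> (e i)) (f' i)"
        using fun_cong[OF eq, of "e i"] i ei e(1) by (simp add: E_def)
      then show "f i = f' i"
        using conjugate_inj[of "\<gamma> (e i)" "f i" "f' i"] \<gamma>[OF ei] Qc(2) f i by blast
    qed (use f in \<open>auto simp: PiE_iff\<close>)
  qed
  show ?thesis by (rule that[OF hom inj])
qed

end

section \<open>Intersection saturation of branch groups\<close>

theorem theorem3p2: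
  fixes G :: "('a, 'b) monoid_scheme"
  assumes "branch_group G"
    and "fin_gen_group G"
    and "\<alpha> \<in> carrier G"
    and "\<not> fin_gen_subgroup G (centraliser G \<alpha>)"
  shows "intersection_saturated G"
  unfolding intersection_saturated_def
proof (intro allI impI)
  fix n :: nat and c :: "nat set \<Rightarrow> nat"
  obtain k \<phi> where br: "branch_action G k \<phi>" using assms(1) by (auto simp: branch_group_def)
  interpret tree_action G k \<phi>
    using br by (auto simp: branch_action_def tree_action_def tree_action_axioms_def)
  define Ix where "Ix = {I. I \<subseteq> {1..n} \<and> I \<noteq> {} \<and> c I \<noteq> 0} \<times> {1..n}"
  \<comment> \<open>Depth \<open>card Ix\<close> is enough: the level then has at least
    \<open>2 ^ l\<close> vertices, one for each coordinate of the power.\<close>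
  define l where "l = card Ix"
  have finIx: "finite Ix"
    unfolding Ix_def by (rule finite_cartesian_product) (auto intro: rev_finite_subset[of "Pow {1..n}"])
  have "card Ix \<le> 2 ^ l" by (simp add: l_def)
  also have "\<dots> \<le> card (tree_level k l)"
    using br by (intro card_tree_level_ge) (simp add: branch_action_def)
  finally obtain e where e: "e ` Ix \<subseteq> tree_level k l" "inj_on e Ix"
    using card_le_inj[OF finIx finite_tree_level] by blast
  let ?K = "rist_level G k \<phi> l"
  have K: "subgroup ?K G" unfolding rist_level_def by (rule generate_is_subgroup[OF rist_level_carrier])
  have fin: "finite (rcosets\<^bsub>G\<^esub> ?K)" using br by (simp add: branch_action_def)
  \<comment> \<open>Passing to a subgroup of finite index cannot make the centraliser finitely
    generated.\<close>
  have "\<not> fin_gen_subgroup G (centraliser G \<alpha> \<inter> ?K)"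
    using fin_gen_subgroup_if_Int_finite_index[OF centraliser_subgroup[OF assms(3)] K fin] assms(4) by blast
  \<comment> \<open>If all return centralisers on the level were finitely generated, so would be the
    intersection just excluded.\<close>
  then obtain v where v: "v \<in> tree_level k l" "\<not> fin_gen_subgroup G (return_centraliser \<alpha> v)"
    using fin_gen_centraliser_Int_rist_level[OF assms(3)] by blast
  let ?R = "G\<lparr>carrier := rist G k \<phi> v\<rparr>"
  \<comment> \<open>This power of \<alpha> fixes \<open>v\<close>, so conjugation by it maps
    \<open>R v\<close> to itself, with \<open>return_centraliser \<alpha> v\<close> as its fixed
    points.\<close>
  define \<theta> where "\<theta> = conjugate (\<alpha> [^]\<^bsub>G\<^esub> return_time \<alpha> v)"
  have p: "\<alpha> [^]\<^bsub>G\<^esub> return_time \<alpha> v \<in> carrier G" using assms(3) by simp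
  have "\<theta> h \<in> rist G k \<phi> v" if "h \<in> rist G k \<phi> v" for h
    using conjugate_rist[OF p level_in_tree[OF v(1)] that] return_time(2)[OF assms(3) v(1)]
    by (simp add: \<theta>_def)
  then have "\<theta> \<in> hom ?R ?R"
    using conjugate_mult[OF p] rist_carrier by (auto intro!: homI simp: \<theta>_def)
  moreover have "fin_gen_group ?R"
    using fin_gen_rist[OF fin_gen_subgroup_finite_index[OF assms(2) K fin] v(1)] .
  moreover have "{h \<in> carrier ?R. \<theta> h = h} = return_centraliser \<alpha> v"
    by (simp add: return_centraliser_def \<theta>_def)
  then have "\<not> fin_gen_subgroup ?R {h \<in> carrier ?R. \<theta> h = h}"
    using v(2) fin_gen_subgroup_consistent[OF rist_subgroup, of "return_centraliser \<alpha> v" v]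
      return_centraliserD(1) by auto
  ultimately have "realisable (product_group Ix (\<lambda>_. ?R)) n c"
    unfolding Ix_def by (intro realisable_power subgroup_imp_group rist_subgroup)
  moreover have "\<exists>g\<in>carrier G. \<phi> g v = u" if "u \<in> tree_level k l" for u
    using br v(1) that by (auto simp: branch_action_def)
  then obtain h where "group_hom (product_group Ix (\<lambda>_. ?R)) G h"
    "inj_on h (carrier (product_group Ix (\<lambda>_. ?R)))"
    using rist_power_embedding[OF v(1) e(2,1)] by blast
  ultimately show "realisable G n c" using realisable_mono by blast
qed

end
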